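(* Let $a,b\in\mathbb R$, $0<h<T$, and assume that either ($a+b<0$ and $ah\le1$) or ($bh<-e^{ah-1}$ and $ah\ge1$). Let $f:\mathbb R\to\mathbb R$ be a $T$-periodic continuous function of sine-like shape. Then the semiflow $F^\mu:X\to X$, $\mu\ge0$, on $X=S^1\times C[-h,0]$ generated by $$u'(t)=a\,u(t)+b\max_{s\in[t-h,t]}u(s)+f(t)$$ (as defined in the context) has a compact global attractor.
   Context: Sine-like shape: a $T$-periodic continuous $f:\mathbb R\to\mathbb R$ has sine-like shape if there exist $t_0,t_1$ with $0<t_1-t_0<T$ such that $f$ is strictly monotone on $[t_0,t_1]$ and on $[t_1,t_0+T]$, and $t_1$ is a turning point of $f$ (the monotonicity changes at $t_1$). Semiflow: $T$ is the minimal period of $f$; $S^1$ is $[0,T]$ with $0$ and $T$ identified; $C[-h,0]$ is the space of continuous real functions on $[-h,0]$ with the sup norm. For $(\tau,\phi)\in X$, let $u(\cdot,\tau,\phi):[\tau-h,\infty)\to\mathbb R$ be the solution of the equation for $t\ge\tau$ with $u(\tau+s)=\phi(s)$, $s\in[-h,0]$ (it exists and is unique). For $\mu\ge0$ set $F^\mu(\tau,\phi)=(\tau_1,\psi)$, where $\tau_1=(\tau+\mu)\bmod T\in[0,T)$ and $\psi(s)=u(\tau+\mu+s,\tau,\phi)$, $s\in[-h,0]$. Then $F^0=\mathrm{Id}$, $F^\mu\circ F^\nu=F^{\mu+\nu}$, and $(x,\mu)\mapsto F^\mu x$ is continuous. A compact global attractor is a compact invariant ($F^\mu\mathcal A=\mathcal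 A$ for all $\mu\ge 0$) connected subset $\mathcal A$ of $X$ attracting every trajectory of the semiflow. *)

theory Defs
  imports "HOL-Analysis.Analysis" "HOL-Library.Real_Mod"
begin

(* "t1 is a turning point" means that the two monotonicity types are opposite. *)
definition sine_like_shape :: "real \<Rightarrow> (real \<Rightarrow> real) \<Rightarrow> bool" where
  "sine_like_shape T f \<longleftrightarrow>
     (\<exists>t0 t1. 0 < t1 - t0 \<and> t1 - t0 < T \<and>
        (strict_mono_on {t0..t1} f \<and> strict_antimono_on {t1..t0 + T} f \<or>
         strict_antimono_on {t0..t1} f \<and> strict_mono_on {t1..t0 + T} f))"

text \<open>
  The circle is the quotient space of the interval from \<open>0\<close> to \<open>T\<close> that identifies its
  endpoints, with representatives in the half-open interval \<open>{0..<T}\<close>.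
\<close>

definition circle_proj :: "real \<Rightarrow> real \<Rightarrow> real" where
  "circle_proj T t = (if t = T then 0 else t)"

definition circle_topology :: "real \<Rightarrow> real topology" where
  "circle_topology T = topology (\<lambda>U. U \<subseteq> {0..<T} \<and>
     openin (top_of_set {0..T}) {t \<in> {0..T}. circle_proj T t \<in> U})"

lemma openin_circle_topology:
  "openin (circle_topology T) U \<longleftrightarrow> U \<subseteq> {0..<T} \<and>
     openin (top_of_set {0..T}) {t \<in> {0..T}. circle_proj T t \<in> U}"
proof -
  have "istopology (\<lambda>U. U \<subseteq> {0..<T} \<and>
          openin (top_of_set {0..T}) {t \<in> {0..T}. circle_proj T t \<in> U})"
    unfolding istopology_def
  proof (intro conjI allI impI)
    fix A B :: "real set"
    assume "A \<subseteq> {0..<T} \<and> openin (top_of_set {0..T}) {t \<in> {0..T}. circle_proj T t \<in> A}"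
      and "B \<subseteq> {0..<T} \<and> openin (top_of_set {0..T}) {t \<in> {0..T}. circle_proj T t \<in> B}"
    moreover have "{t \<in> {0..T}. circle_proj T t \<in> A \<inter> B} =
        {t \<in> {0..T}. circle_proj T t \<in> A} \<inter> {t \<in> {0..T}. circle_proj T t \<in> B}"
      by auto
    ultimately show "A \<inter> B \<subseteq> {0..<T}"
      and "openin (top_of_set {0..T}) {t \<in> {0..T}. circle_proj T t \<in> A \<inter> B}"
      by auto
  next
    fix K :: "real set set"
    assume *: "\<forall>A\<in>K. A \<subseteq> {0..<T} \<and>
      openin (top_of_set {0..T}) {t \<in> {0..T}. circle_proj T t \<in> A}"
    then show "\<Union>K \<subseteq> {0..<T}" by blast
    have "{t \<in> {0..T}. circle_proj T t \<in> \<Union>K} =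
        \<Union>((\<lambda>A. {t \<in> {0..T}. circle_proj T t \<in> A}) ` K)"
      by auto
    then show "openin (top_of_set {0..T}) {t \<in> {0..T}. circle_proj T t \<in> \<Union>K}"
      using * by (auto intro!: openin_Union)
  qed
  then show ?thesis
    by (simp add: circle_topology_def)
qed

lemma topspace_circle_topology:
  assumes "0 < T"
  shows "topspace (circle_topology T) = {0..<T}"
proof -
  have "{t \<in> {0..T}. circle_proj T t \<in> {0..<T}} = {0..T}"
    using assms by (auto simp: circle_proj_def)
  then have "openin (circle_topology T) {0..<T}"
    by (simp add: openin_circle_topology)
  then show ?thesis
    by (metis openin_circle_topology openin_subset openin_topspace subset_antisym)
qed

lemma quotient_map_circle_proj:
  assumes "0 < T"
  shows "quotient_map (top_of_set {0..T}) (circle_topology T) (circle_proj T)"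
proof -
  have "circle_proj T ` {0..T} = {0..<T}"
    using assms by (force simp: circle_proj_def)
  then show ?thesis
    using assms
    by (auto simp: quotient_map_def topspace_circle_topology openin_circle_topology)
qed

text \<open>
  Continuous real functions on \<open>{-h..0}\<close> with the sup metric; as usual for
  \<open>cfunspace\<close>, its elements are extensional, i.e. \<open>undefined\<close> outside \<open>{-h..0}\<close>.
\<close>

definition history_space :: "real \<Rightarrow> (real \<Rightarrow> real) metric" where
  "history_space h = cfunspace (top_of_set {-h..0}) euclidean_metric"

definition phase_space :: "real \<Rightarrow> real \<Rightarrow> (real \<times> (real \<Rightarrow> real)) topology" where
  "phase_space T h = prod_topology (circle_topology T) (mtopology_of (history_space h))"

lemma mspace_history_space:
  "mspace (history_space h) = {\<phi> \<in> extensional {-h..0}. continuous_on {-h..0} \<phi>}"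
proof -
  have "bounded (\<phi> ` {-h..0})" if "continuous_on {-h..0} \<phi>" for \<phi> :: "real \<Rightarrow> real"
    using compact_continuous_image [OF that compact_Icc] by (rule compact_imp_bounded)
  then show ?thesis
    by (auto simp: history_space_def)
qed

(* The derivative at the initial time is one-sided.  The supremum is a maximum,
   since u is continuous on the compact interval {t - h..t}. *)
definition is_solution ::
  "real \<Rightarrow> real \<Rightarrow> real \<Rightarrow> (real \<Rightarrow> real) \<Rightarrow> real \<Rightarrow> (real \<Rightarrow> real) \<Rightarrow> (real \<Rightarrow> real) \<Rightarrow> bool" where
  "is_solution a b h f \<tau> \<phi> u \<longleftrightarrow>
     continuous_on {\<tau> - h..} u \<and>
     (\<forall>s\<in>{-h..0}. u (\<tau> + s) = \<phi> s) \<and>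
     (\<forall>t\<ge>\<tau>. (u has_real_derivative
        (a * u t + b * (SUP s\<in>{t - h..t}. u s) + f t)) (at t within {\<tau>..}))"

(* Solutions are only determined on {\<tau> - h..}; extensionality makes the choice unique. *)
definition solution ::
  "real \<Rightarrow> real \<Rightarrow> real \<Rightarrow> (real \<Rightarrow> real) \<Rightarrow> real \<Rightarrow> (real \<Rightarrow> real) \<Rightarrow> real \<Rightarrow> real" where
  "solution a b h f \<tau> \<phi> = (THE u. u \<in> extensional {\<tau> - h..} \<and> is_solution a b h f \<tau> \<phi> u)"

definition semiflow_map ::
  "real \<Rightarrow> real \<Rightarrow> real \<Rightarrow> real \<Rightarrow> (real \<Rightarrow> real) \<Rightarrow> real
     \<Rightarrow> real \<times> (real \<Rightarrow> real) \<Rightarrow> real \<times> (real \<Rightarrow> real)" where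
  "semiflow_map a b h T f \<mu> = (\<lambda>(\<tau>, \<phi>).
     ((\<tau> + \<mu>) rmod T, restrict (\<lambda>s. solution a b h f \<tau> \<phi> (\<tau> + \<mu> + s)) {-h..0}))"

(* Attraction is phrased with neighbourhoods of A.  For compact nonempty A in a metrizable
   space this says that the distance from F \<mu> x to A tends to 0; the empty set attracts
   nothing. *)
definition compact_global_attractor ::
  "'a topology \<Rightarrow> (real \<Rightarrow> 'a \<Rightarrow> 'a) \<Rightarrow> 'a set \<Rightarrow> bool" where
  "compact_global_attractor X F A \<longleftrightarrow>
     compactin X A \<and> connectedin X A \<and>
     (\<forall>\<mu>\<ge>0. F \<mu> ` A = A) \<and>
     (\<forall>x\<in>topspace X. \<forall>U. openin X U \<and> A \<subseteq> U \<longrightarrow> (\<forall>\<^sub>F \<mu> in at_top. F \<mu> x \<in> U))"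

end

theory Submission
  imports Defs "HOL-Complex_Analysis.Great_Picard"
begin

text \<open>
  The semiflow is uniformly dissipative: all solutions starting from a bounded set of histories enter
  one fixed ball after a common time. Once a solution is bounded, the equation bounds its slope,
  so after a further delay its history lies in the set \<open>B\<close> of functions on \<open>{-h..0}\<close> with
  fixed bounds on the values and on the Lipschitz constant. By Arzela and Ascoli \<open>B\<close> is compact; it
  is also star-shaped around \<open>0\<close>, hence connected. So \<open>Q = {0..<T} \<times> B\<close> is a compact connected set
  that every trajectory enters and that the semiflow maps into itself from some time \<open>p\<close> on. The sets
  \<open>F (n p) ` Q\<close> decrease, and their intersection is the attractor (\<open>attractor_from_absorbing_set\<close>).

  Dissipativity rests on the sign of \<open>a + b\<close> and on the characteristic equation. Since the maximum is at least
  the present value, \<open>u' \<le> (a + b) u + K\<close> for \<open>b \<le> 0\<close> and \<open>\<bar>f\<bar> \<le> K\<close>, and \<open>a + b < 0\<close> controls \<open>u\<close>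
  from above. From below the danger is a negative solution that runs away like \<open>- exp (l t)\<close> with
  \<open>l \<ge> 0\<close>. Such a solution is nonincreasing, so its maximum over the window is its oldest value and
  \<open>l = a + b exp (- l h)\<close>. The hypothesis on the parameters excludes roots \<open>l \<ge> 0\<close> of this
  characteristic equation (\<open>characteristic_gap\<close>). The nonlinear argument iterates the same
  computation: a bound \<open>l\<close> for the growth rate of \<open>- u\<close> over one window implies the bound
  \<open>a + b exp (- l h) + small\<close> after one more delay, and this is below \<open>l\<close> by a fixed amount. After
  finitely many delays the rate is negative (\<open>very_negative_solution_increases\<close>). For \<open>b \<ge> 0\<close>
  the equation obeys a Halanay inequality, and an exponentially decaying barrier suffices.

  Solutions exist by a contraction in an exponentially weighted sup norm, and a barrier
  estimate gives both uniqueness and continuous dependence on the initial time and the history.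
\<close>

section \<open>Attractors from compact connected absorbing sets\<close>

text \<open>
  Otherwise the closed sets \<open>C n - U\<close> would be nonempty and nested in a compact space.
\<close>

lemma nested_compact_subset_open:
  fixes C :: "nat \<Rightarrow> 'a set"
  assumes haus: "Hausdorff_space X" and comp: "\<And>n. compactin X (C n)"
    and dec: "decseq C" and U: "openin X U" and sub: "(\<Inter>n. C n) \<subseteq> U"
  shows "\<exists>n. C n \<subseteq> U"
proof (rule ccontr)
  assume not: "\<nexists>n. C n \<subseteq> U"
  let ?Y = "subtopology X (C 0)"
  have clo: "closedin X (C n - U)" for n
    using compactin_imp_closedin [OF haus comp] U by (simp add: closedin_diff)
  have "(\<Inter>n. C n - U) \<noteq> {}"
  proof (rule compact_space_imp_nest)
    show "compact_space ?Y"
      using comp compact_space_subtopology by blast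
    show "closedin ?Y (C n - U)" for n
    proof (rule closedin_subset_topspace [OF clo])
      show "C n - U \<subseteq> C 0" using decseqD [OF dec, of 0 n] by auto
    qed
    show "C n - U \<noteq> {}" for n using not by auto
    show "decseq (\<lambda>n. C n - U)"
      using dec by (auto simp: decseq_def)
  qed
  then show False using sub by blast
qed

text \<open>
  Two disjoint compact pieces of the intersection have disjoint open neighbourhoods, whose union
  contains some \<open>C n\<close>; so they would already disconnect \<open>C n\<close>.
\<close>

lemma nested_compact_connectedin:
  fixes C :: "nat \<Rightarrow> 'a set"
  assumes haus: "Hausdorff_space X" and comp: "\<And>n. compactin X (C n)"
    and conn: "\<And>n. connectedin X (C n)" and dec: "decseq C"
  shows "connectedin X (\<Inter>n. C n)"
proof (rule ccontr)
  define A where "A = (\<Inter>n. C n)"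
  have clA: "closedin X A"
    using compactin_imp_closedin [OF haus comp] by (auto simp: A_def)
  have cA: "compactin X A"
    by (rule closed_compactin [OF comp [of 0] _ clA]) (auto simp: A_def)
  have "A \<subseteq> topspace X" by (rule closedin_subset [OF clA])
  moreover assume "\<not> connectedin X (\<Inter>n. C n)"
  ultimately have "\<exists>E1 E2. closedin X E1 \<and> closedin X E2 \<and> A \<subseteq> E1 \<union> E2 \<and>
      E1 \<inter> E2 \<inter> A = {} \<and> E1 \<inter> A \<noteq> {} \<and> E2 \<inter> A \<noteq> {}"
    unfolding A_def [symmetric] connectedin_closedin by meson
  then obtain E1 E2 where E: "closedin X E1" "closedin X E2" "A \<subseteq> E1 \<union> E2"
      "E1 \<inter> E2 \<inter> A = {}" "E1 \<inter> A \<noteq> {}" "E2 \<inter> A \<noteq> {}"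
    by (elim exE conjE)
  have "compactin X (E1 \<inter> A)" "compactin X (E2 \<inter> A)" "disjnt (E1 \<inter> A) (E2 \<inter> A)"
    using E closed_Int_compactin [OF E(1) cA] closed_Int_compactin [OF E(2) cA]
    by (auto simp: disjnt_def)
  then obtain U V where UV: "openin X U" "openin X V" "E1 \<inter> A \<subseteq> U" "E2 \<inter> A \<subseteq> V" "disjnt U V"
    using Hausdorff_space_compact_separation [OF haus] by metis
  have "A \<subseteq> U \<union> V" using UV E(3) by blast
  then obtain n where "C n \<subseteq> U \<union> V"
    using nested_compact_subset_open [OF haus comp dec, of "U \<union> V"] UV by (auto simp: A_def)
  moreover have "A \<subseteq> C n" by (auto simp: A_def)
  ultimately have "C n \<subseteq> U \<union> V" "U \<inter> C n \<noteq> {}" "V \<inter> C n \<noteq> {}" "U \<inter> V \<inter> C n = {}"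
    using UV(3-5) E(5,6) by (auto simp: disjnt_def)
  then show False
    using conn [of n] UV(1,2) unfolding connectedin by meson
qed

text \<open>
  The attractor is the intersection of the images \<open>C n = F (n p) ` Q\<close>, which decrease because
  \<open>F p\<close> maps \<open>Q\<close> into itself. Compactness and connectedness pass to the nested intersection, and
  every neighbourhood of it contains some \<open>C n\<close>, which gives attraction. A point \<open>x\<close> of the
  attractor has preimages under \<open>F t\<close> in every \<open>C n\<close>; by compactness it has one in their
  intersection, so the attractor lies in its own image.
\<close>

lemma attractor_from_absorbing_set:
  fixes F :: "real \<Rightarrow> 'a \<Rightarrow> 'a"
  assumes haus: "Hausdorff_space X"
    and cont: "\<And>t. 0 \<le> t \<Longrightarrow> continuous_map X X (F t)"
    and semi: "\<And>s t x. \<lbrakk>0 \<le> s; 0 \<le> t; x \<in> topspace X\<rbrakk> \<Longrightarrow> F (s + t) x = F s (F t x)"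
    and Q: "compactin X Q" "connectedin X Q" "Q \<noteq> {}"
    and p: "0 < p" "\<And>t. p \<le> t \<Longrightarrow> F t ` Q \<subseteq> Q"
    and absorb: "\<And>x. x \<in> topspace X \<Longrightarrow> \<exists>t\<ge>0. F t x \<in> Q"
  shows "\<exists>A. compact_global_attractor X F A"
proof -
  define C where "C n = F (real n * p) ` Q" for n
  define A where "A = (\<Inter>n. C n)"
  have QX: "Q \<subseteq> topspace X" using Q(1) by (rule compactin_subset_topspace)
  have np: "0 \<le> real n * p" for n using p(1) by simp
  have compC: "compactin X (C n)" and connC: "connectedin X (C n)" for n
    unfolding C_def using image_compactin [OF Q(1) cont] connectedin_continuous_map_image [OF cont Q(2)] np
    by auto
  have into: "F (t + real n * p) ` Q \<subseteq> C n" if "p \<le> t" for t n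
  proof
    fix y assume "y \<in> F (t + real n * p) ` Q"
    then obtain x where x: "x \<in> Q" "y = F (real n * p + t) x" by (auto simp: add.commute)
    then have "y = F (real n * p) (F t x)" using semi [OF np, of t x] QX p that by auto
    moreover have "F t x \<in> Q" using p(2) [OF that] x by auto
    ultimately show "y \<in> C n" unfolding C_def by auto
  qed
  have "C (Suc n) \<subseteq> C n" for n
    using into [of p n] by (simp add: C_def algebra_simps)
  then have dec: "decseq C" by (simp add: decseq_Suc_iff)
  have CX: "C n \<subseteq> topspace X" for n using compC compactin_subset_topspace by blast
  have clC: "closedin X (C n)" for n using compactin_imp_closedin [OF haus compC] .
  have cA: "compactin X A" unfolding A_def
    by (rule closed_compactin [OF compC [of 0]]) (use clC in auto)
  have connA: "connectedin X A" unfolding A_def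
    by (rule nested_compact_connectedin [OF haus compC connC dec])
  have big: "\<exists>m::nat. r \<le> real m * p" for r
    using reals_Archimedean3 [OF p(1)] less_imp_le by blast
  have fwd: "F t ` A \<subseteq> A" if "0 \<le> t" for t
  proof -
    have "F t x \<in> C n" if "x \<in> A" for x n
    proof -
      obtain y where y: "y \<in> Q" "x = F (real (Suc n) * p) y"
        using \<open>x \<in> A\<close> unfolding A_def C_def by blast
      then have "F t x = F (t + real (Suc n) * p) y"
        using semi [OF \<open>0 \<le> t\<close> np, of y "Suc n"] QX by auto
      also have "t + real (Suc n) * p = (t + p) + real n * p" by (simp add: algebra_simps)
      finally show ?thesis using into [of "t + p" n] \<open>0 \<le> t\<close> y by auto
    qed
    then show ?thesis unfolding A_def by blast
  qed
  have bwd: "A \<subseteq> F t ` A" if "0 \<le> t" for t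
  proof
    fix x assume "x \<in> A"
    have xX: "x \<in> topspace X" using \<open>x \<in> A\<close> CX unfolding A_def by blast
    \<comment> \<open>the preimages of \<open>x\<close> at stage \<open>n\<close>: closed, nested and, as shown below, nonempty\<close>
    define D where "D n = {y \<in> topspace X. F t y \<in> {x}} \<inter> C n" for n
    have clD: "closedin X (D n)" for n unfolding D_def
      by (intro closedin_Int clC closedin_continuous_map_preimage [OF cont [OF \<open>0 \<le> t\<close>]]
            closedin_Hausdorff_singleton haus xX)
    have "(\<Inter>n. D n) \<noteq> {}"
    proof (rule compact_space_imp_nest [of "subtopology X (C 0)"])
      show "compact_space (subtopology X (C 0))" using compC compact_space_subtopology by blast
      show "closedin (subtopology X (C 0)) (D n)" for n
        by (rule closedin_subset_topspace [OF clD])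
           (use decseqD [OF dec, of 0 n] in \<open>auto simp: D_def\<close>)
      show "decseq D" using dec by (auto simp: D_def decseq_def)
      show "D n \<noteq> {}" for n
      proof -
        obtain m where m: "t + p \<le> real m * p" using big by blast
        have "x \<in> C (n + m)" using \<open>x \<in> A\<close> unfolding A_def by blast
        then obtain y where y: "y \<in> Q" "x = F (real (n + m) * p) y" unfolding C_def by blast
        define s where "s = real m * p - t"
        have s: "p \<le> s" using m by (simp add: s_def)
        have eq: "real (n + m) * p = t + (s + real n * p)" by (simp add: s_def algebra_simps)
        have "x = F t (F (s + real n * p) y)"
          using semi [of t "s + real n * p" y] y QX \<open>0 \<le> t\<close> s p(1) np [of n] unfolding eq by auto
        moreover have "F (s + real n * p) y \<in> C n" using into [OF s, of n] y by auto
        ultimately show ?thesis using CX unfolding D_def by blast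
      qed
    qed
    then obtain y where "y \<in> (\<Inter>n. D n)" by blast
    then show "x \<in> F t ` A" unfolding D_def A_def by blast
  qed
  have attr: "\<forall>\<^sub>F t in at_top. F t x \<in> U"
    if x: "x \<in> topspace X" and U: "openin X U" "A \<subseteq> U" for x U
  proof -
    obtain n where n: "C n \<subseteq> U"
      using nested_compact_subset_open [OF haus compC dec U(1)] U(2) unfolding A_def by blast
    obtain s where s: "0 \<le> s" "F s x \<in> Q" using absorb [OF x] by blast
    have "F t x \<in> U" if t: "t \<ge> p + real n * p + s" for t
    proof -
      define r where "r = t - s - real n * p"
      have "F t x = F ((r + real n * p) + s) x" by (simp add: r_def)
      also have "\<dots> = F (r + real n * p) (F s x)"
        using semi [of "r + real n * p" s x] s x t np [of n] p(1) by (simp add: r_def)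
      also have "\<dots> \<in> C n" using into [of r n] t s by (auto simp: r_def)
      finally show ?thesis using n by blast
    qed
    then show ?thesis by (auto simp: eventually_at_top_linorder)
  qed
  show ?thesis unfolding compact_global_attractor_def
    using cA connA fwd bwd attr by (intro exI [of _ A]) (auto simp: subset_antisym)
qed

section \<open>Barriers and linear differential inequalities\<close>

lemma has_derivative_at_from_halfline:
  fixes g :: "real \<Rightarrow> real"
  assumes "(g has_real_derivative D) (at t within {0..})" "0 < t"
  shows "(g has_real_derivative D) (at t)"
proof -
  have "t \<in> interior {0::real..}" using assms(2) by (simp add: interior_real_atLeast)
  then show ?thesis using assms(1) at_within_interior by metis
qed

lemma continuous_on_halfline_if_deriv:
  fixes g :: "real \<Rightarrow> real"
  assumes "\<And>t. 0 \<le> t \<Longrightarrow> (g has_real_derivative g' t) (at t within {0..})"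
  shows "continuous_on {0..} g"
  by (rule DERIV_continuous_on [where D = g']) (use assms in auto)

text \<open>
  The barrier principle used for all estimates below: at the first zero \<open>t\<close> the function
  arrives from negative values, so its derivative there cannot be negative.
\<close>

lemma first_crossing:
  fixes g g' :: "real \<Rightarrow> real"
  assumes deriv: "\<And>t. 0 \<le> t \<Longrightarrow> (g has_real_derivative g' t) (at t within {0..})"
    and init: "g 0 < 0"
    and cross: "\<And>t. \<lbrakk>0 < t; t \<le> T; \<forall>s\<in>{0..<t}. g s < 0; g t = 0\<rbrakk> \<Longrightarrow> g' t < 0"
    and t: "0 \<le> t" "t \<le> T"
  shows "g t < 0"
proof (rule ccontr)
  assume "\<not> g t < 0"
  define S where "S = {s \<in> {0..t}. 0 \<le> g s}"
  have contg: "continuous_on {0..x} g" for x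
    by (rule continuous_on_subset [OF continuous_on_halfline_if_deriv [OF deriv]]) auto
  have "closed S" unfolding S_def
    by (rule continuous_on_closed_Collect_le) (auto intro: contg)
  moreover have "S \<subseteq> {0..t}" by (auto simp: S_def)
  ultimately have "compact S"
    using bounded_subset [OF bounded_closed_interval] compact_eq_bounded_closed by blast
  moreover have "S \<noteq> {}" using \<open>\<not> g t < 0\<close> t by (auto simp: S_def)
  ultimately obtain r where r: "r \<in> S" "\<forall>s\<in>S. r \<le> s" using compact_attains_inf by blast
  have r0: "0 < r" "r \<le> t" "0 \<le> g r" using r(1) init by (auto simp: S_def order.order_iff_strict)
  have neg: "g s < 0" if "s \<in> {0..<r}" for s
    using that r(2) r0(2) by (force simp: S_def)
  obtain x where x: "0 \<le> x" "x \<le> r" "g x = 0"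
    using IVT' [of g 0 0 r] init r0 contg by auto
  then have "g r = 0" using neg [of x] r0 by (cases "x = r") auto
  then have g'r: "g' r < 0" using cross [of r] neg r0 t by auto
  have "DERIV g r :> g' r" using has_derivative_at_from_halfline [OF deriv] r0 by auto
  then obtain d where d: "0 < d" "\<And>y. \<lbrakk>0 < y; y < d\<rbrakk> \<Longrightarrow> g r < g (r - y)"
    using DERIV_neg_dec_left g'r by metis
  define y where "y = min (d / 2) (r / 2)"
  have y: "0 < y" "y < d" "y < r" using d(1) r0(1) by (auto simp: y_def)
  then show False using d(2) [of y] neg [of "r - y"] \<open>g r = 0\<close> by auto
qed

lemma nonincreasing_if_deriv_nonpos:
  fixes g g' :: "real \<Rightarrow> real"
  assumes deriv: "\<And>t. 0 \<le> t \<Longrightarrow> (g has_real_derivative g' t) (at t within {0..})"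
    and "0 \<le> s" "s \<le> t" and nonpos: "\<And>r. \<lbrakk>s < r; r < t\<rbrakk> \<Longrightarrow> g' r \<le> 0"
  shows "g t \<le> g s"
proof (rule DERIV_nonpos_imp_decreasing_open [OF \<open>s \<le> t\<close>])
  show "\<exists>y. DERIV g r :> y \<and> y \<le> 0" if "s < r" "r < t" for r
    using has_derivative_at_from_halfline [OF deriv, of r] nonpos [of r] that \<open>0 \<le> s\<close>
    by (intro exI [of _ "g' r"]) simp
  show "continuous_on {s..t} g"
    by (rule continuous_on_subset [OF continuous_on_halfline_if_deriv [OF deriv]]) (use \<open>0 \<le> s\<close> in auto)
qed

text \<open>
  The function \<open>(y + c / l) exp (- l t)\<close> is nonincreasing. The case \<open>l = 0\<close> is
  included for \<open>c = 0\<close>, where \<open>c / l\<close> is \<open>0\<close> by convention.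
\<close>

lemma linear_comparison:
  fixes y y' :: "real \<Rightarrow> real"
  assumes deriv: "\<And>t. 0 \<le> t \<Longrightarrow> (y has_real_derivative y' t) (at t within {0..})"
    and "0 \<le> s" "s \<le> t" and le: "\<And>r. \<lbrakk>s \<le> r; r \<le> t\<rbrakk> \<Longrightarrow> y' r \<le> l * y r + c"
    and lc: "l \<noteq> 0 \<or> c = 0"
  shows "y t + c / l \<le> (y s + c / l) * exp (l * (t - s))"
proof -
  define g where "g r = (y r + c / l) * exp (- l * r)" for r
  have "g t \<le> g s"
  proof (rule nonincreasing_if_deriv_nonpos [OF _ \<open>0 \<le> s\<close> \<open>s \<le> t\<close>])
    show "(g has_real_derivative (y' r - l * y r - c) * exp (- l * r)) (at r within {0..})"
      if "0 \<le> r" for r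
      unfolding g_def
      by (rule derivative_eq_intros deriv [OF that] refl | use lc in \<open>auto simp: algebra_simps\<close>)+
    show "(y' r - l * y r - c) * exp (- l * r) \<le> 0" if "s < r" "r < t" for r
      using le [of r] that by (intro mult_nonpos_nonneg) auto
  qed
  then have "g t * exp (l * t) \<le> g s * exp (l * t)" by simp
  moreover have "g t * exp (l * t) = y t + c / l"
    by (simp add: g_def mult.assoc flip: exp_add)
  moreover have "g s * exp (l * t) = (y s + c / l) * exp (l * (t - s))"
    by (simp add: g_def mult.assoc algebra_simps flip: exp_add)
  ultimately show ?thesis by simp
qed

lemma last_crossing:
  fixes v :: "real \<Rightarrow> real"
  assumes cont: "continuous_on {s..t} v" and "s \<le> t" "v s \<le> C" "C < v t"
  obtains r where "s \<le> r" "r < t" "v r = C" "\<And>x. \<lbrakk>r \<le> x; x \<le> t\<rbrakk> \<Longrightarrow> C \<le> v x"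
proof -
  define S where "S = {x \<in> {s..t}. v x \<le> C}"
  have "closed S" unfolding S_def
    by (rule continuous_on_closed_Collect_le) (auto intro: cont)
  moreover have "S \<subseteq> {s..t}" by (auto simp: S_def)
  ultimately have "compact S"
    using bounded_subset [OF bounded_closed_interval] compact_eq_bounded_closed by blast
  moreover have "S \<noteq> {}" using assms by (auto simp: S_def)
  ultimately obtain r where r: "r \<in> S" "\<forall>x\<in>S. x \<le> r" using compact_attains_sup by blast
  have rt: "s \<le> r" "r \<le> t" "v r \<le> C" using r(1) by (auto simp: S_def)
  have above: "C < v x" if "r < x" "x \<le> t" for x
  proof -
    have "x \<notin> S" using that(1) r(2) by (meson not_le)
    then show ?thesis using that rt by (auto simp: S_def)
  qed
  have "continuous_on {r..t} v" by (rule continuous_on_subset [OF cont]) (use rt in auto)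
  then obtain x where x: "r \<le> x" "x \<le> t" "v x = C"
    using IVT' [of v r C t] rt \<open>C < v t\<close> by auto
  then have "v r = C" using above [of x] by (cases "x = r") auto
  show thesis
  proof
    show "r < t" using rt \<open>C < v t\<close> by (cases "r = t") auto
    show "C \<le> v x" if "r \<le> x" "x \<le> t" for x
      using above [of x] that \<open>v r = C\<close> by (cases "x = r") auto
  qed fact+
qed

section \<open>Estimates for solutions of the equation with maxima\<close>

lemma window_sup_attained:
  fixes u :: "real \<Rightarrow> real"
  assumes "continuous_on {t - h..t} u" "0 \<le> h"
  obtains s where "s \<in> {t - h..t}" "(SUP s\<in>{t - h..t}. u s) = u s" "\<And>r. r \<in> {t - h..t} \<Longrightarrow> u r \<le> u s"
proof -
  obtain s where s: "s \<in> {t - h..t}" "\<forall>r\<in>{t - h..t}. u r \<le> u s"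
    using continuous_attains_sup [of "{t - h..t}" u] assms by auto
  then have "(SUP s\<in>{t - h..t}. u s) = u s"
    by (intro cSup_eq_maximum) auto
  with s that show thesis by blast
qed

lemma window_sup_le:
  fixes u :: "real \<Rightarrow> real"
  assumes "0 \<le> h" "\<And>s. s \<in> {t - h..t} \<Longrightarrow> u s \<le> c"
  shows "(SUP s\<in>{t - h..t}. u s) \<le> c"
  by (rule cSUP_least) (use assms in auto)

lemma window_sup_ge:
  fixes u :: "real \<Rightarrow> real"
  assumes "continuous_on {t - h..t} u" "s \<in> {t - h..t}"
  shows "u s \<le> (SUP s\<in>{t - h..t}. u s)"
proof -
  have "0 \<le> h" using assms(2) by auto
  then show ?thesis using window_sup_attained [OF assms(1)] assms(2) by metis
qed

text \<open>
  Taking the maximum over a window is nonexpansive for the sup norm. The two windows may be placed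
  at different times, which also yields continuity of the moving maximum.
\<close>

lemma window_sup_diff:
  fixes u v :: "real \<Rightarrow> real"
  assumes u: "continuous_on {t - h..t} u" and v: "continuous_on {t' - h..t'} v" and "0 \<le> h"
    and le: "\<And>s. s \<in> {0..h} \<Longrightarrow> \<bar>u (t - s) - v (t' - s)\<bar> \<le> e"
  shows "\<bar>(SUP s\<in>{t - h..t}. u s) - (SUP s\<in>{t' - h..t'}. v s)\<bar> \<le> e"
proof -
  have 1: "(SUP s\<in>{t - h..t}. u s) \<le> (SUP s\<in>{t' - h..t'}. v s) + e"
  proof (rule window_sup_le [OF \<open>0 \<le> h\<close>])
    fix s assume "s \<in> {t - h..t}"
    then show "u s \<le> (SUP s\<in>{t' - h..t'}. v s) + e"
      using window_sup_ge [OF v, of "t' - (t - s)"] le [of "t - s"] by auto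
  qed
  have 2: "(SUP s\<in>{t' - h..t'}. v s) \<le> (SUP s\<in>{t - h..t}. u s) + e"
  proof (rule window_sup_le [OF \<open>0 \<le> h\<close>])
    fix s assume "s \<in> {t' - h..t'}"
    then show "v s \<le> (SUP s\<in>{t - h..t}. u s) + e"
      using window_sup_ge [OF u, of "t - (t' - s)"] le [of "t' - s"] by auto
  qed
  show ?thesis using 1 2 by linarith
qed

definition max_rhs :: "real \<Rightarrow> real \<Rightarrow> real \<Rightarrow> (real \<Rightarrow> real) \<Rightarrow> (real \<Rightarrow> real) \<Rightarrow> real \<Rightarrow> real" where
  "max_rhs a b h f u t = a * u t + b * (SUP s\<in>{t - h..t}. u s) + f t"

lemma is_solution_0D:
  assumes "is_solution a b h f 0 \<phi> u"
  shows "continuous_on {-h..} u"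
    and "\<And>s. s \<in> {-h..0} \<Longrightarrow> u s = \<phi> s"
    and "\<And>t. 0 \<le> t \<Longrightarrow> (u has_real_derivative max_rhs a b h f u t) (at t within {0..})"
    and "\<And>t. 0 \<le> t \<Longrightarrow> continuous_on {t - h..t} u"
proof -
  show c: "continuous_on {-h..} u"
    and "\<And>s. s \<in> {-h..0} \<Longrightarrow> u s = \<phi> s"
    and "\<And>t. 0 \<le> t \<Longrightarrow> (u has_real_derivative max_rhs a b h f u t) (at t within {0..})"
    using assms by (auto simp: is_solution_def max_rhs_def)
  show "continuous_on {t - h..t} u" if "0 \<le> t" for t
    by (rule continuous_on_subset [OF c]) (use that in auto)
qed

text \<open>
  A Gronwall estimate for the delay equation, by the barrier \<open>E t = D exp ((\<bar>a\<bar> + \<bar>b\<bar> + 1) t)\<close>. At a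
  first time with \<open>\<bar>u - v\<bar> = E\<close> the difference on the whole window is at most \<open>E t\<close> because \<open>E\<close>
  is increasing, so the difference grows at a rate of at most \<open>(\<bar>a\<bar> + \<bar>b\<bar>) E t + D < E' t\<close>. The
  squares make the absolute value differentiable.
\<close>

lemma solution_difference_bound:
  assumes u: "is_solution a b h f 0 \<phi> u" and v: "is_solution a b h g 0 \<psi> v" and "0 \<le> h"
    and "0 < D" and init: "\<And>s. s \<in> {-h..0} \<Longrightarrow> \<bar>\<phi> s - \<psi> s\<bar> < D"
    and forcing: "\<And>s. s \<in> {0..T} \<Longrightarrow> \<bar>f s - g s\<bar> \<le> D" and t: "t \<in> {0..T}"
  shows "\<bar>u t - v t\<bar> \<le> D * exp ((\<bar>a\<bar> + \<bar>b\<bar> + 1) * t)"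
proof -
  note U = is_solution_0D [OF u] and V = is_solution_0D [OF v]
  define L where "L = \<bar>a\<bar> + \<bar>b\<bar>"
  define E where "E t = D * exp ((L + 1) * t)" for t
  define d where "d t = u t - v t" for t
  define d' where "d' t = max_rhs a b h f u t - max_rhs a b h g v t" for t
  have L: "0 \<le> L" by (simp add: L_def)
  have Epos: "0 < E t" for t using \<open>0 < D\<close> by (simp add: E_def)
  have Emono: "E s \<le> E t" if "s \<le> t" for s t
    using that \<open>0 < D\<close> L by (simp add: E_def mult_left_mono)
  have d0: "\<bar>d s\<bar> < D" if "s \<in> {-h..0}" for s
    using init [OF that] U(2) [OF that] V(2) [OF that] by (simp add: d_def)
  have "(d t)\<^sup>2 - (E t)\<^sup>2 < 0"
  proof (rule first_crossing [where T = T and g = "\<lambda>t. (d t)\<^sup>2 - (E t)\<^sup>2" and t = t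
        and g' = "\<lambda>t. 2 * (d t * d' t) - 2 * ((L + 1) * (E t)\<^sup>2)"])
    show "((\<lambda>t. (d t)\<^sup>2 - (E t)\<^sup>2) has_real_derivative 2 * (d r * d' r) - 2 * ((L + 1) * (E r)\<^sup>2))
        (at r within {0..})" if "0 \<le> r" for r
      unfolding d_def d'_def E_def
      by (rule derivative_eq_intros U(3) [OF that] V(3) [OF that] refl
          | simp add: algebra_simps power2_eq_square)+
    have "\<bar>d 0\<bar> < \<bar>E 0\<bar>" using d0 [of 0] \<open>0 \<le> h\<close> \<open>0 < D\<close> by (auto simp: E_def)
    then show "(d 0)\<^sup>2 - (E 0)\<^sup>2 < 0" using abs_le_square_iff [of "E 0" "d 0"] by linarith
    fix r assume r: "0 < r" "r \<le> T" "\<forall>s\<in>{0..<r}. (d s)\<^sup>2 - (E s)\<^sup>2 < 0" "(d r)\<^sup>2 - (E r)\<^sup>2 = 0"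
    have dr: "\<bar>d r\<bar> = E r" using r(4) Epos [of r] power2_eq_iff [of "d r" "E r"] by auto
    have win: "\<bar>d s\<bar> \<le> E r" if "s \<in> {r - h..r}" for s
    proof -
      consider "s \<in> {-h..0}" | "s \<in> {0..<r}" | "s = r" using \<open>s \<in> {r - h..r}\<close> r(1) by fastforce
      then show ?thesis
      proof cases
        case 1
        then show ?thesis using d0 [OF 1] Emono [of 0 r] r(1) by (simp add: E_def)
      next
        case 2
        then have "(d s)\<^sup>2 < (E s)\<^sup>2" using r(3) by auto
        then have "\<bar>d s\<bar> < E s" using Epos [of s] abs_le_square_iff [of "E s" "d s"] by force
        then show ?thesis using Emono [of s r] 2 by auto
      next
        case 3 then show ?thesis using dr by simp
      qed
    qed
    have "\<bar>(SUP s\<in>{r - h..r}. u s) - (SUP s\<in>{r - h..r}. v s)\<bar> \<le> E r"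
      by (rule window_sup_diff) (use U(4) V(4) r(1) win \<open>0 \<le> h\<close> in \<open>auto simp: d_def\<close>)
    then have bM: "\<bar>b * ((SUP s\<in>{r - h..r}. u s) - (SUP s\<in>{r - h..r}. v s))\<bar> \<le> \<bar>b\<bar> * E r"
      by (simp add: abs_mult mult_left_mono)
    have aD: "\<bar>a * d r\<bar> = \<bar>a\<bar> * E r" by (simp add: abs_mult dr)
    have fD: "\<bar>f r - g r\<bar> \<le> D" using forcing r(1,2) by auto
    have "d' r = a * d r + b * ((SUP s\<in>{r - h..r}. u s) - (SUP s\<in>{r - h..r}. v s)) + (f r - g r)"
      by (simp add: d'_def d_def max_rhs_def algebra_simps)
    then have "\<bar>d' r\<bar> \<le> L * E r + D"
      using bM aD fD by (simp add: L_def algebra_simps)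
    also have "\<dots> < (L + 1) * E r"
      using \<open>0 < D\<close> r(1) L by (simp add: E_def algebra_simps add_pos_nonneg)
    finally have "\<bar>d r\<bar> * \<bar>d' r\<bar> < E r * ((L + 1) * E r)"
      unfolding dr using Epos by (intro mult_strict_left_mono)
    then have "d r * d' r < (L + 1) * (E r)\<^sup>2"
      by (simp add: power2_eq_square algebra_simps flip: abs_mult)
    then show "2 * (d r * d' r) - 2 * ((L + 1) * (E r)\<^sup>2) < 0" by simp
  qed (use t in auto)
  then have "\<bar>d t\<bar> \<le> \<bar>E t\<bar>" using abs_le_square_iff [of "d t" "E t"] by auto
  then show ?thesis using Epos [of t] by (simp add: d_def E_def L_def)
qed

lemma solution_crude_bound:
  assumes u: "is_solution a b h f 0 \<phi> u" and "0 \<le> h" "0 \<le> R" "0 \<le> K"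
    and "\<And>s. s \<in> {-h..0} \<Longrightarrow> \<bar>\<phi> s\<bar> \<le> R" and "\<And>s. \<bar>f s\<bar> \<le> K" and "0 \<le> t"
  shows "\<bar>u t\<bar> \<le> (R + K + 1) * exp ((\<bar>a\<bar> + \<bar>b\<bar> + 1) * t)"
proof -
  have "is_solution a b h (\<lambda>_. 0) 0 (\<lambda>_. 0) (\<lambda>_. 0)"
    using \<open>0 \<le> h\<close> by (auto simp: is_solution_def)
  then have "\<bar>u t - 0\<bar> \<le> (R + K + 1) * exp ((\<bar>a\<bar> + \<bar>b\<bar> + 1) * t)"
  proof (rule solution_difference_bound [OF u _ \<open>0 \<le> h\<close>, where T = t])
    show "\<bar>\<phi> s - 0\<bar> < R + K + 1" if "s \<in> {-h..0}" for s using assms(4) assms(5) [OF that] by simp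
    show "\<bar>f s - 0\<bar> \<le> R + K + 1" for s using assms(3) assms(6) [of s] by simp
  qed (use assms in auto)
  then show ?thesis by simp
qed

text \<open>
  The maximum over the window is at least the present value, and \<open>b \<le> 0\<close>, hence
  \<open>u' \<le> (a + b) u + K\<close>.
\<close>

lemma upper_bound_nonpos_delay:
  assumes u: "is_solution a b h f 0 \<phi> u" and "0 \<le> h" "b \<le> 0" "a + b < 0"
    and f: "\<And>s. \<bar>f s\<bar> \<le> K" and "0 \<le> t"
  shows "u t \<le> K / - (a + b) + (u 0 - K / - (a + b)) * exp ((a + b) * t)"
proof -
  note U = is_solution_0D [OF u]
  have le: "max_rhs a b h f u r \<le> (a + b) * u r + K" if "0 \<le> r" for r
  proof -
    have "u r \<le> (SUP s\<in>{r - h..r}. u s)"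
      by (rule window_sup_ge [OF U(4)]) (use that \<open>0 \<le> h\<close> in auto)
    then have "b * (SUP s\<in>{r - h..r}. u s) \<le> b * u r" using \<open>b \<le> 0\<close> by (rule mult_left_mono_neg)
    then show ?thesis using f [of r] by (simp add: max_rhs_def algebra_simps)
  qed
  have "u t + K / (a + b) \<le> (u 0 + K / (a + b)) * exp ((a + b) * (t - 0))"
    by (rule linear_comparison [OF U(3)]) (use le assms in auto)
  then show ?thesis by (simp add: divide_minus_right del: minus_add_distrib)
qed

lemma exp_decay_le:
  fixes R e c :: real
  assumes "0 < c" "0 < e"
  obtains t0 where "0 \<le> t0" "\<And>t. t0 \<le> t \<Longrightarrow> R * exp (- c * t) \<le> e"
proof -
  define t0 where "t0 = \<bar>R\<bar> / (c * e)"
  show thesis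
  proof
    show "0 \<le> t0" using assms by (simp add: t0_def)
    fix t assume "t0 \<le> t"
    then have "\<bar>R\<bar> \<le> e * (c * t)" using assms by (simp add: t0_def field_simps)
    also have "\<dots> \<le> e * exp (c * t)"
      using assms exp_ge_add_one_self [of "c * t"] by (intro mult_left_mono) linarith+
    finally have "R \<le> e * exp (c * t)" by linarith
    then have "R * exp (- c * t) \<le> e * exp (c * t) * exp (- c * t)" by (intro mult_right_mono) auto
    also have "\<dots> = e" by (simp add: mult.assoc flip: exp_add)
    finally show "R * exp (- c * t) \<le> e" .
  qed
qed

section \<open>Uniform dissipativity\<close>

text \<open>
  Halanay's inequality. For small \<open>e > 0\<close> with \<open>a + b exp (e h) < - e\<close> the function
  \<open>E t = N + R exp (- e t)\<close> with \<open>N > K / - (a + b)\<close> is a strict upper barrier for \<open>\<bar>u\<bar>\<close>: on the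
  window before \<open>t\<close> it is at most \<open>E (t - h)\<close>.
\<close>

lemma dissipative_nonneg_delay:
  assumes "0 < h" "0 \<le> b" "a + b < 0" "0 \<le> K" "0 \<le> R"
  obtains t0 where "0 \<le> t0"
    "\<And>f \<phi> u t. \<lbrakk>is_solution a b h f 0 \<phi> u; \<forall>s. \<bar>f s\<bar> \<le> K; \<forall>s\<in>{-h..0}. \<bar>\<phi> s\<bar> \<le> R; t0 \<le> t\<rbrakk>
      \<Longrightarrow> \<bar>u t\<bar> \<le> K / - (a + b) + 2"
proof -
  have "((\<lambda>e. a + b * exp (e * h) + e) \<longlongrightarrow> a + b * exp (0 * h) + 0) (at_right 0)"
    by (intro tendsto_intros)
  then have "\<forall>\<^sub>F e in at_right 0. a + b * exp (e * h) + e < 0"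
    by (rule order_tendstoD(2)) (use assms in simp)
  moreover have "\<forall>\<^sub>F e in at_right (0::real). 0 < e" by (rule eventually_at_right_less)
  ultimately have "\<forall>\<^sub>F e in at_right 0. 0 < e \<and> a + b * exp (e * h) + e < 0"
    by (rule eventually_conj[rotated])
  then obtain e where e: "0 < e" "a + b * exp (e * h) + e < 0"
    using eventually_happens' [OF trivial_limit_at_right_real] by blast
  define N where "N = K / - (a + b) + 1"
  have q: "(a + b) * (K / - (a + b)) = - K" using assms(3) by (simp add: divide_simps algebra_simps)
  then have N: "(a + b) * N + K < 0"
    using assms(3) unfolding N_def distrib_left q by simp
  have "0 \<le> K / - (a + b)" using assms(3,4) by (intro divide_nonneg_pos) auto
  then have N0: "0 < N" by (simp add: N_def)
  define E where "E t = N + R * exp (- e * t)" for t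
  have Epos: "0 < E t" for t using N0 assms by (simp add: E_def add_pos_nonneg)
  have Emono: "E t \<le> E s" if "s \<le> t" for s t
    using that assms e by (simp add: E_def mult_left_mono)
  have main: "\<bar>u t\<bar> \<le> E t"
    if u: "is_solution a b h f 0 \<phi> u" and f: "\<forall>s. \<bar>f s\<bar> \<le> K"
      and init: "\<forall>s\<in>{-h..0}. \<bar>\<phi> s\<bar> \<le> R" and t: "0 \<le> t" for f \<phi> u t
  proof -
    note U = is_solution_0D [OF u]
    have u0: "\<bar>u s\<bar> < E s" if "s \<in> {-h..0}" for s
    proof -
      have "R * 1 \<le> R * exp (- e * s)" using that e assms by (intro mult_left_mono) (auto simp: mult_nonneg_nonpos)
      moreover have "\<bar>u s\<bar> \<le> R" using init U(2) [OF that] that by simp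
      ultimately show ?thesis using N0 by (simp add: E_def)
    qed
    have "(u t)\<^sup>2 - (E t)\<^sup>2 < 0"
    proof (rule first_crossing [where g = "\<lambda>t. (u t)\<^sup>2 - (E t)\<^sup>2" and t = t and T = t
          and g' = "\<lambda>t. 2 * (u t * max_rhs a b h f u t) - 2 * (E t * (- e * (R * exp (- e * t))))"])
      show "((\<lambda>t. (u t)\<^sup>2 - (E t)\<^sup>2) has_real_derivative
          2 * (u r * max_rhs a b h f u r) - 2 * (E r * (- e * (R * exp (- e * r)))))
          (at r within {0..})" if "0 \<le> r" for r
        unfolding E_def
        by (rule derivative_eq_intros U(3) [OF that] refl | simp add: algebra_simps power2_eq_square)+
      show "(u 0)\<^sup>2 - (E 0)\<^sup>2 < 0"
        using abs_le_square_iff [of "E 0" "u 0"] u0 [of 0] Epos [of 0] \<open>0 < h\<close> by auto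
      fix r assume r: "0 < r" "\<forall>s\<in>{0..<r}. (u s)\<^sup>2 - (E s)\<^sup>2 < 0" "(u r)\<^sup>2 - (E r)\<^sup>2 = 0"
      have ur: "\<bar>u r\<bar> = E r" using r(3) Epos [of r] power2_eq_iff [of "u r" "E r"] by auto
      have win: "\<bar>u s\<bar> \<le> E (r - h)" if "s \<in> {r - h..r}" for s
      proof -
        consider "s \<in> {-h..0}" | "s \<in> {0..<r}" | "s = r" using \<open>s \<in> {r - h..r}\<close> r(1) by fastforce
        then have "\<bar>u s\<bar> \<le> E s"
        proof cases
          case 1 then show ?thesis using u0 [OF 1] by simp
        next
          case 2
          then have "(u s)\<^sup>2 < (E s)\<^sup>2" using r(2) by auto
          then show ?thesis using Epos [of s] abs_le_square_iff [of "u s" "E s"] by force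
        next
          case 3 then show ?thesis using ur by simp
        qed
        also have "E s \<le> E (r - h)" using that by (intro Emono) auto
        finally show ?thesis .
      qed
      obtain s where "s \<in> {r - h..r}" "(SUP s\<in>{r - h..r}. u s) = u s"
        by (rule window_sup_attained [OF U(4) [of r]]) (use r(1) \<open>0 < h\<close> in auto)
      then have M: "\<bar>SUP s\<in>{r - h..r}. u s\<bar> \<le> E (r - h)" using win by auto
      have "u r * max_rhs a b h f u r = a * (u r)\<^sup>2 + b * (u r * (SUP s\<in>{r - h..r}. u s)) + u r * f r"
        by (simp add: max_rhs_def algebra_simps power2_eq_square)
      also have "\<dots> \<le> a * (E r)\<^sup>2 + b * (E r * E (r - h)) + E r * K"
      proof (intro add_mono)
        show "a * (u r)\<^sup>2 \<le> a * (E r)\<^sup>2" using r(3) by simp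
        have "\<bar>u r * (SUP s\<in>{r - h..r}. u s)\<bar> \<le> E r * E (r - h)"
          unfolding abs_mult ur using M Epos [of r] by (intro mult_left_mono) auto
        then show "b * (u r * (SUP s\<in>{r - h..r}. u s)) \<le> b * (E r * E (r - h))"
          using assms(2) by (intro mult_left_mono) auto
        have "\<bar>u r * f r\<bar> \<le> E r * K"
          unfolding abs_mult ur using f Epos [of r] by (intro mult_left_mono) auto
        then show "u r * f r \<le> E r * K" by simp
      qed
      also have "\<dots> = E r * (((a + b) * N + K) + R * exp (- e * r) * (a + b * exp (e * h)))"
        by (simp add: E_def algebra_simps power2_eq_square flip: exp_add)
      also have "\<dots> < E r * (- e * (R * exp (- e * r)))"
      proof (rule mult_strict_left_mono [OF _ Epos])
        have "R * exp (- e * r) * (a + b * exp (e * h)) \<le> R * exp (- e * r) * (- e)"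
          using e assms by (intro mult_left_mono) auto
        then show "((a + b) * N + K) + R * exp (- e * r) * (a + b * exp (e * h)) < - e * (R * exp (- e * r))"
          using N by (simp add: algebra_simps)
      qed
      finally show "2 * (u r * max_rhs a b h f u r) - 2 * (E r * (- e * (R * exp (- e * r)))) < 0" by simp
    qed (use t in auto)
    then show ?thesis using Epos [of t] abs_le_square_iff [of "u t" "E t"] by force
  qed
  obtain t0 where t0: "0 \<le> t0" "\<And>t. t0 \<le> t \<Longrightarrow> R * exp (- e * t) \<le> 1"
    using exp_decay_le [OF e(1), of 1] by auto
  show thesis
  proof (rule that [OF t0(1)])
    fix f \<phi> u t
    assume A: "is_solution a b h f 0 \<phi> u" "\<forall>s. \<bar>f s\<bar> \<le> K" "\<forall>s\<in>{-h..0}. \<bar>\<phi> s\<bar> \<le> R" "t0 \<le> t"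
    show "\<bar>u t\<bar> \<le> K / - (a + b) + 2"
      using main [OF A(1-3), of t] t0(1) t0(2) [OF A(4)] A(4) unfolding E_def N_def by linarith
  qed
qed

text \<open>
  The function on the right is the defect in the characteristic equation of the decreasing
  exponentials \<open>- exp (l t)\<close>. Its sign follows from \<open>1 + x \<le> exp x\<close>, taken at \<open>x = - l h\<close> in the
  first case and at \<open>x = a h - 1 - l h\<close>, the tangent point of the threshold, in the second case.
\<close>

lemma characteristic_gap:
  fixes a b h l :: real
  assumes "0 < h" and cond: "(a + b < 0 \<and> a * h \<le> 1) \<or> (b * h < - exp (a * h - 1) \<and> a * h \<ge> 1)"
    and "0 \<le> l" and "b < 0"
  shows "0 < l - a - b * exp (- l * h)"
  using cond
proof
  assume c: "a + b < 0 \<and> a * h \<le> 1"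
  show ?thesis
  proof (cases "l < a")
    case False
    have "b * exp (- l * h) < 0" using \<open>b < 0\<close> by (simp add: mult_neg_pos)
    then show ?thesis using False by simp
  next
    case True
    then have "0 < a" using \<open>0 \<le> l\<close> by simp
    have "a - l \<le> a * (1 - l * h)" using c \<open>0 \<le> l\<close> mult_left_mono [of "a * h" 1 l] by (simp add: algebra_simps)
    also have "\<dots> \<le> a * exp (- l * h)"
      using exp_ge_add_one_self [of "- l * h"] \<open>0 < a\<close> by (intro mult_left_mono) auto
    also have "\<dots> < - b * exp (- l * h)" using c by (intro mult_strict_right_mono) auto
    finally show ?thesis by simp
  qed
next
  assume c: "b * h < - exp (a * h - 1) \<and> a * h \<ge> 1"
  have "a * h - l * h \<le> exp (a * h - 1 - l * h)" using exp_ge_add_one_self [of "a * h - 1 - l * h"] by simp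
  also have "\<dots> = exp (a * h - 1) * exp (- l * h)" by (simp flip: exp_add)
  also have "\<dots> < - (b * h) * exp (- l * h)" using c by (intro mult_strict_right_mono) auto
  finally have "0 < (l - a - b * exp (- l * h)) * h" by (simp add: algebra_simps)
  then show ?thesis using \<open>0 < h\<close> by (simp add: zero_less_mult_iff)
qed

text \<open>
  In the second case \<open>a h \<le> exp (a h - 1) < - b h\<close>.
\<close>

lemma delay_condition_imp_sum_neg:
  fixes a b h :: real
  assumes "0 < h" and cond: "(a + b < 0 \<and> a * h \<le> 1) \<or> (b * h < - exp (a * h - 1) \<and> a * h \<ge> 1)"
  shows "a + b < 0"
proof -
  have "(a + b) * h < 0" if "b * h < - exp (a * h - 1)"
    using that exp_ge_add_one_self [of "a * h - 1"] by (simp add: algebra_simps)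
  then show ?thesis using cond \<open>0 < h\<close> by (auto simp: mult_less_0_iff)
qed

text \<open>
  One step of the improvement of the growth rate of \<open>- u\<close>. If \<open>- u\<close> has grown at a rate of at most \<open>l\<close>
  over the window, then every value of \<open>- u\<close> in the window, also the smallest, is at least
  \<open>exp (- l h)\<close> times the present value. As \<open>b < 0\<close>, the delay term reduces the growth
  rate to \<open>a + b exp (- l h)\<close>; one \<open>d\<close> of the gap \<open>2 d\<close> absorbs the forcing, which is small
  relative to \<open>C\<close>, and the other is gained.
\<close>

lemma growth_rate_step:
  assumes u: "is_solution a b h f 0 \<phi> u" and "0 < h" "b < 0" "0 \<le> l" "0 < C" "h \<le> t"
    and f: "\<And>s. \<bar>f s\<bar> \<le> K" and K: "K \<le> d * C" and "0 \<le> d"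
    and low: "\<And>s. s \<in> {t - h..t} \<Longrightarrow> u s \<le> - C"
    and rate: "\<And>s. s \<in> {t - h..t} \<Longrightarrow> l * u s \<le> max_rhs a b h f u s"
    and gap: "2 * d \<le> l - a - b * exp (- l * h)"
  shows "(l - d) * u t \<le> max_rhs a b h f u t"
proof -
  note U = is_solution_0D [OF u]
  obtain s where s: "s \<in> {t - h..t}" "(SUP s\<in>{t - h..t}. u s) = u s"
    by (rule window_sup_attained [OF U(4) [of t]]) (use \<open>h \<le> t\<close> \<open>0 < h\<close> in auto)
  have ut: "u t \<le> - C" using low \<open>0 < h\<close> by auto
  have "- u t + 0 / l \<le> (- u s + 0 / l) * exp (l * (t - s))"
  proof (rule linear_comparison)
    show "((\<lambda>r. - u r) has_real_derivative - max_rhs a b h f u r) (at r within {0..})" if "0 \<le> r" for r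
      by (rule derivative_intros U(3) that)+
    show "- max_rhs a b h f u r \<le> l * - u r + 0" if "s \<le> r" "r \<le> t" for r
      using rate [of r] that s(1) by simp
  qed (use s(1) \<open>h \<le> t\<close> in auto)
  also have "\<dots> \<le> - u s * exp (l * h)"
    using s(1) low [OF s(1)] \<open>0 < C\<close> \<open>0 \<le> l\<close> by (auto intro!: mult_left_mono)
  finally have "u s * exp (l * h) * exp (- l * h) \<le> u t * exp (- l * h)"
    by (intro mult_right_mono) auto
  then have "u s \<le> u t * exp (- l * h)" by (simp add: mult.assoc flip: exp_add)
  then have "b * (u t * exp (- l * h)) \<le> b * (SUP s\<in>{t - h..t}. u s)"
    using s(2) \<open>b < 0\<close> by (simp add: mult_left_mono_neg)
  moreover have "(l - a - b * exp (- l * h)) * u t \<le> 2 * d * u t"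
    using gap ut \<open>0 < C\<close> by (intro mult_right_mono_neg) auto
  moreover have "d * u t \<le> d * - C" using ut \<open>0 \<le> d\<close> by (rule mult_left_mono)
  moreover have "- K \<le> f t" using f [of t] by simp
  ultimately show ?thesis using K unfolding max_rhs_def by (simp add: algebra_simps)
qed

text \<open>
  On the compact interval of rates between \<open>0\<close> and \<open>max a 0 + 1\<close> the gap has a positive lower
  bound \<open>2 d\<close>. The upper end is a valid initial rate, since the delay term only pushes a negative
  solution upwards. Each delay lowers the rate by \<open>d\<close>, down to \<open>- d\<close> after a number of delays that
  does not depend on the solution.
\<close>

lemma very_negative_solution_increases:
  assumes "0 < h" "b < 0" "0 \<le> K" and gap: "\<And>l. 0 \<le> l \<Longrightarrow> 0 < l - a - b * exp (- l * h)"
  obtains C d H where "0 < C" "0 < d" "h \<le> H"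
    "\<And>f \<phi> u t0 t. \<lbrakk>is_solution a b h f 0 \<phi> u; \<forall>s. \<bar>f s\<bar> \<le> K; 0 \<le> t0; \<forall>s\<in>{t0..t}. u s \<le> - C; t0 + H \<le> t\<rbrakk>
      \<Longrightarrow> d * C \<le> max_rhs a b h f u t"
proof -
  define l0 where "l0 = max a 0 + 1"
  have l0: "0 < l0" "a + 1 \<le> l0" by (auto simp: l0_def)
  have "continuous_on {0..l0} (\<lambda>l. l - a - b * exp (- l * h))" by (intro continuous_intros)
  then obtain m where m: "m \<in> {0..l0}"
      "\<forall>l\<in>{0..l0}. m - a - b * exp (- m * h) \<le> l - a - b * exp (- l * h)"
    using continuous_attains_inf [of "{0..l0}" "\<lambda>l. l - a - b * exp (- l * h)"] l0 by auto
  \<comment> \<open>\<open>d \<le> 1\<close> makes \<open>a + d \<le> l0\<close>, so the rate \<open>l0\<close> also absorbs the forcing at the start\<close>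
  define d where "d = min 1 ((m - a - b * exp (- m * h)) / 2)"
  have d: "0 < d" "d \<le> 1" using gap [of m] m(1) by (auto simp: d_def)
  have gap2: "2 * d \<le> l - a - b * exp (- l * h)" if "l \<in> {0..l0}" for l
    using bspec [OF m(2) that] by (simp add: d_def min_def)
  define C where "C = K / d + 1"
  have C: "0 < C" "K \<le> d * C" using d \<open>0 \<le> K\<close> by (auto simp: C_def field_simps add_pos_nonneg)
  \<comment> \<open>the bound on the growth rate after \<open>k\<close> delays, truncated at \<open>0\<close>: a negative rate need not be kept for the next step\<close>
  define \<nu> where "\<nu> k = max (l0 - real k * d) 0" for k :: nat
  have \<nu>: "\<nu> k \<in> {0..l0}" for k using d l0 by (auto simp: \<nu>_def)
  obtain n :: nat where n: "l0 < real n * d" using reals_Archimedean3 [OF d(1)] by blast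
  then have \<nu>n: "\<nu> n = 0" by (simp add: \<nu>_def)
  define H where "H = real (n + 2) * h"
  have rate: "\<nu> k * u t \<le> max_rhs a b h f u t"
    if u: "is_solution a b h f 0 \<phi> u" and f: "\<forall>s. \<bar>f s\<bar> \<le> K" and "0 \<le> t0"
      and low: "\<forall>s\<in>{t0..t1}. u s \<le> - C" and t: "t0 + real (k + 1) * h \<le> t" "t \<le> t1"
    for f \<phi> u t0 t1 t k
    using t
  proof (induction k arbitrary: t)
    case 0
    have t: "t0 + h \<le> t" using 0(1) by simp
    have "(SUP s\<in>{t - h..t}. u s) \<le> - C"
      by (rule window_sup_le) (use \<open>0 < h\<close> low 0 in auto)
    then have "0 \<le> b * (SUP s\<in>{t - h..t}. u s)" using C(1) \<open>b < 0\<close> by (intro mult_nonpos_nonpos) auto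
    moreover have ut: "u t \<le> - C" using low t 0 \<open>0 < h\<close> \<open>0 \<le> t0\<close> by auto
    moreover have "l0 * u t \<le> (a + d) * u t" using ut C(1) l0 d by (intro mult_right_mono_neg) auto
    moreover have "d * u t \<le> d * - C" using ut d by (intro mult_left_mono) auto
    moreover have "- K \<le> f t" using f by (metis abs_le_D2 minus_le_iff)
    moreover have "\<nu> 0 = l0" using l0 by (simp add: \<nu>_def)
    ultimately show ?case using C(2) unfolding max_rhs_def by (simp add: algebra_simps)
  next
    case (Suc k)
    have kh: "0 \<le> real k * h" using \<open>0 < h\<close> by simp
    have t: "t0 + real (k + 1) * h \<le> t - h" using Suc.prems(1) by (simp add: algebra_simps)
    have "real (k + 1) * h = real k * h + h" by (simp add: algebra_simps)
    then have "t0 \<le> t - h" using t kh \<open>0 < h\<close> by linarith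
    then have inw: "s \<in> {t0..t1}" if "s \<in> {t - h..t}" for s
      using that Suc.prems(2) by auto
    have "(\<nu> k - d) * u t \<le> max_rhs a b h f u t"
    proof (rule growth_rate_step [OF u \<open>0 < h\<close> \<open>b < 0\<close> _ C(1) _ _ C(2)])
      show "u s \<le> - C" if "s \<in> {t - h..t}" for s using inw [OF that] low by blast
      show "\<nu> k * u s \<le> max_rhs a b h f u s" if "s \<in> {t - h..t}" for s
        using Suc.IH [of s] t that Suc.prems(2) by auto
      show "h \<le> t" using \<open>t0 \<le> t - h\<close> \<open>0 \<le> t0\<close> by simp
    qed (use \<nu> [of k] gap2 [OF \<nu>] f d in auto)
    moreover have "u t \<le> 0" using inw [of t] low C(1) \<open>0 < h\<close> by force
    moreover have "\<nu> k - d \<le> \<nu> (Suc k)" using d by (auto simp: \<nu>_def algebra_simps)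
    ultimately show ?case using mult_right_mono_neg [of "\<nu> k - d" "\<nu> (Suc k)" "u t"] by linarith
  qed
  show thesis
  proof (rule that [OF C(1) d(1)])
    show "h \<le> H" using \<open>0 < h\<close> by (simp add: H_def algebra_simps)
    fix f \<phi> u t0 t
    assume u: "is_solution a b h f 0 \<phi> u" and f: "\<forall>s. \<bar>f s\<bar> \<le> K" and "0 \<le> t0"
      and low: "\<forall>s\<in>{t0..t}. u s \<le> - C" and t: "t0 + H \<le> t"
    have nh: "0 \<le> real n * h" using \<open>0 < h\<close> by simp
    have t': "t0 + real (n + 1) * h \<le> t - h" using t by (simp add: H_def algebra_simps)
    have "real (n + 1) * h = real n * h + h" by (simp add: algebra_simps)
    then have "t0 \<le> t - h" using t' nh \<open>0 < h\<close> by linarith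
    then have t0t: "t0 \<le> t - h" "h \<le> t" using \<open>0 \<le> t0\<close> by auto
    have "(0 - d) * u t \<le> max_rhs a b h f u t"
    proof (rule growth_rate_step [OF u \<open>0 < h\<close> \<open>b < 0\<close> _ C(1) t0t(2) _ C(2)])
      show "u s \<le> - C" if "s \<in> {t - h..t}" for s using that low t0t by auto
      show "0 * u s \<le> max_rhs a b h f u s" if "s \<in> {t - h..t}" for s
        using rate [OF u f \<open>0 \<le> t0\<close> low, of n s] that t' unfolding \<nu>n by auto
      show "2 * d \<le> 0 - a - b * exp (- 0 * h)" using gap2 [of 0] l0 by auto
    qed (use f d in auto)
    moreover have "d * u t \<le> d * - C" using low t0t \<open>0 < h\<close> d(1) by (intro mult_left_mono) auto
    ultimately show "d * C \<le> max_rhs a b h f u t" by simp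
  qed
qed


text \<open>
  After the upper bound \<open>N\<close> has been reached, \<open>v = - u\<close> cannot stay above \<open>C\<close>: after time \<open>H\<close> it
  would decrease at speed \<open>d C\<close>, starting from a height \<open>G\<close> that depends only on \<open>R\<close>. After the last
  time at which \<open>v = C\<close>, the growth lasts at most \<open>H\<close>, at a rate of at most \<open>l v + c\<close>, before
  \<open>v\<close> decreases. This limits the overshoot to \<open>V\<close>, independently of \<open>R\<close>.
\<close>

lemma dissipative_neg_delay:
  assumes "0 < h" "b < 0" "a + b < 0" "0 \<le> K"
    and gap: "\<And>l. 0 \<le> l \<Longrightarrow> 0 < l - a - b * exp (- l * h)"
  obtains R0 where "\<And>R. 0 \<le> R \<Longrightarrow> \<exists>t0\<ge>0. \<forall>f \<phi> u t. is_solution a b h f 0 \<phi> u \<longrightarrow>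
      (\<forall>s. \<bar>f s\<bar> \<le> K) \<longrightarrow> (\<forall>s\<in>{-h..0}. \<bar>\<phi> s\<bar> \<le> R) \<longrightarrow> t0 \<le> t \<longrightarrow> \<bar>u t\<bar> \<le> R0"
proof -
  obtain C d H where C: "0 < C" "0 < d" "h \<le> H"
    and inc: "\<And>f \<phi> u t0 t. \<lbrakk>is_solution a b h f 0 \<phi> u; \<forall>s. \<bar>f s\<bar> \<le> K; 0 \<le> t0;
        \<forall>s\<in>{t0..t}. u s \<le> - C; t0 + H \<le> t\<rbrakk> \<Longrightarrow> d * C \<le> max_rhs a b h f u t"
    using very_negative_solution_increases [OF \<open>0 < h\<close> \<open>b < 0\<close> \<open>0 \<le> K\<close> gap] by blast
  have dC: "0 < d * C" using C by simp
  define N where "N = K / - (a + b) + 1"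
  define l where "l = max a 0 + 1"
  define c where "c = \<bar>b\<bar> * N + K"
  define V where "V = (C + c / l) * exp (l * H)"
  have N: "0 < N" unfolding N_def
    using divide_nonneg_pos [of K "- (a + b)"] assms(3,4) by linarith
  have l: "0 < l" "a \<le> l" by (auto simp: l_def)
  have c: "0 \<le> c" using N assms(4) by (simp add: c_def)
  have V: "C \<le> V"
  proof -
    have "C * 1 \<le> (C + c / l) * exp (l * H)"
      using C \<open>0 < h\<close> l c by (intro mult_mono) auto
    then show ?thesis by (simp add: V_def)
  qed
  show thesis
  proof (rule that [of "max N V"])
    fix R :: real assume "0 \<le> R"
    obtain t1 where t1: "0 \<le> t1" "\<And>t. t1 \<le> t \<Longrightarrow> R * exp (- (- (a + b)) * t) \<le> 1"
      using exp_decay_le [of "- (a + b)" 1 R] assms(3) by auto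
    \<comment> \<open>one delay after \<open>t1\<close> the upper bound \<open>N\<close> holds on the whole window\<close>
    define t0 where "t0 = t1 + h"
    define G where "G = (R + K + 1) * exp ((\<bar>a\<bar> + \<bar>b\<bar> + 1) * (t0 + H))"
    have G: "0 \<le> G" using \<open>0 \<le> R\<close> assms(4) by (simp add: G_def)
    define t2 where "t2 = t0 + H + G / (d * C)"
    have t02: "0 \<le> t0" "t0 + H \<le> t2" "t0 \<le> t2"
      using t1(1) C G dC \<open>0 < h\<close> by (auto simp: t0_def t2_def)
    have "\<bar>u t\<bar> \<le> max N V"
      if u: "is_solution a b h f 0 \<phi> u" and f: "\<forall>s. \<bar>f s\<bar> \<le> K"
        and init: "\<forall>s\<in>{-h..0}. \<bar>\<phi> s\<bar> \<le> R" and t: "t2 \<le> t" for f \<phi> u t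
    proof -
      note U = is_solution_0D [OF u]
      have upper: "u s \<le> N" if "t1 \<le> s" for s
      proof -
        have "u s \<le> K / - (a + b) + (u 0 - K / - (a + b)) * exp ((a + b) * s)"
          using upper_bound_nonpos_delay [OF u] assms f that t1(1) by simp
        also have "\<dots> \<le> K / - (a + b) + R * exp ((a + b) * s)"
        proof (intro add_left_mono mult_right_mono)
          have "\<bar>u 0\<bar> \<le> R" using init U(2) [of 0] \<open>0 < h\<close> by auto
          moreover have "0 \<le> K / - (a + b)" using assms(3,4) by (intro divide_nonneg_pos) auto
          ultimately show "u 0 - K / - (a + b) \<le> R" by linarith
        qed auto
        also have "\<dots> \<le> N" using t1(2) [OF that] by (simp add: N_def add.commute)
        finally show ?thesis .
      qed
      define v where "v s = - u s" for s
      define v' where "v' s = - max_rhs a b h f u s" for s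
      have v: "(v has_real_derivative v' s) (at s within {0..})" if "0 \<le> s" for s
        unfolding v_def v'_def by (rule derivative_intros U(3) that)+
      have v'le: "v' s \<le> l * v s + c" if "t0 \<le> s" "0 \<le> v s" for s
      proof -
        have "(SUP r\<in>{s - h..s}. u r) \<le> N"
          by (rule window_sup_le) (use upper that(1) \<open>0 < h\<close> in \<open>auto simp: t0_def\<close>)
        then have "b * N \<le> b * (SUP r\<in>{s - h..s}. u r)" using \<open>b < 0\<close> by (intro mult_left_mono_neg) auto
        moreover have "a * v s \<le> l * v s" using l that(2) by (intro mult_right_mono)
        moreover have "- K \<le> f s" using f by (metis abs_le_D2 minus_le_iff)
        moreover have "\<bar>b\<bar> = - b" using \<open>b < 0\<close> by simp
        ultimately show ?thesis unfolding v'_def v_def max_rhs_def c_def by (auto simp: algebra_simps simp del: mult_le_cancel_left mult_le_cancel_right mult_le_cancel_left_neg mult_le_cancel_left_pos)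
      qed
      have lower: "v t \<le> V"
      proof (rule ccontr)
        assume "\<not> v t \<le> V"
        then have vt: "V < v t" by simp
        show False
        proof (cases "\<exists>s\<in>{t0..t}. v s \<le> C")
          case False
          have "v t + d * C * t \<le> v (t0 + H) + d * C * (t0 + H)"
          proof (rule nonincreasing_if_deriv_nonpos [where g = "\<lambda>s. v s + d * C * s" and s = "t0 + H"])
            show "((\<lambda>s. v s + d * C * s) has_real_derivative v' s + d * C) (at s within {0..})"
              if "0 \<le> s" for s
              by (rule derivative_eq_intros v that refl | simp)+
            show "v' s + d * C \<le> 0" if "t0 + H < s" "s < t" for s
              using inc [OF u f t02(1), of s] False that by (force simp: v'_def v_def)
          qed (use t02 t C \<open>0 < h\<close> in auto)
          moreover have "v (t0 + H) \<le> G"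
            using solution_crude_bound [OF u, of R K "t0 + H"] \<open>0 < h\<close> \<open>0 \<le> R\<close> \<open>0 \<le> K\<close> init f t02 C
            by (auto simp: v_def G_def)
          moreover have "d * C * (t0 + H) + G \<le> d * C * t"
          proof -
            have "d * C * t2 \<le> d * C * t" using t dC by (intro mult_left_mono) auto
            moreover have "d * C * t2 = d * C * (t0 + H) + G"
              using C by (simp add: t2_def distrib_left)
            ultimately show ?thesis by simp
          qed
          ultimately show False using vt V C(1) by linarith
        next
          case True
          then obtain s where s: "t0 \<le> s" "s \<le> t" "v s \<le> C" by auto
          have "continuous_on {s..t} v"
            by (rule continuous_on_subset [OF continuous_on_halfline_if_deriv [OF v]])
               (use s t02 in auto)
          then obtain r where r: "s \<le> r" "r < t" "v r = C" "\<And>x. \<lbrakk>r \<le> x; x \<le> t\<rbrakk> \<Longrightarrow> C \<le> v x"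
            using last_crossing [of s t v C] s vt V by (metis le_less_trans)
          have near: "v x \<le> V" if "r \<le> x" "x \<le> t" "x \<le> r + H" for x
          proof -
            have "v x + c / l \<le> (v r + c / l) * exp (l * (x - r))"
            proof (rule linear_comparison [OF v])
              show "v' y \<le> l * v y + c" if "r \<le> y" "y \<le> x" for y
                using v'le [of y] r(4) [of y] r(1) s(1) that \<open>x \<le> t\<close> C(1) by auto
            qed (use r s t02 that l in auto)
            also have "\<dots> \<le> V" unfolding V_def r(3)
              using that l c C(1) by (intro mult_left_mono) auto
            finally show ?thesis using c l by (smt (verit) divide_nonneg_nonneg)
          qed
          show False
          proof (cases "t \<le> r + H")
            case True then show False using near [of t] r(2) vt by auto
          next
            case False
            have "v t \<le> v (r + H)"
            proof (rule nonincreasing_if_deriv_nonpos [OF v])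
              show "v' x \<le> 0" if "r + H < x" "x < t" for x
                using inc [OF u f, of r x] r s that t02 dC by (force simp: v'_def v_def)
            qed (use False r s t02 C \<open>0 < h\<close> in auto)
            then show False using near [of "r + H"] False vt C \<open>0 < h\<close> by auto
          qed
        qed
      qed
      have "t1 \<le> t" using t t02 \<open>0 < h\<close> by (simp add: t0_def)
      then show ?thesis using upper [of t] lower V C N by (auto simp: v_def abs_le_iff)
    qed
    then show "\<exists>t0\<ge>0. \<forall>f \<phi> u t. is_solution a b h f 0 \<phi> u \<longrightarrow>
      (\<forall>s. \<bar>f s\<bar> \<le> K) \<longrightarrow> (\<forall>s\<in>{-h..0}. \<bar>\<phi> s\<bar> \<le> R) \<longrightarrow> t0 \<le> t \<longrightarrow> \<bar>u t\<bar> \<le> max N V"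
      using t02 by (intro exI [of _ t2]) auto
  qed
qed

text \<open>
  The time \<open>t0\<close> depends only on the bound \<open>R\<close> of the history. It is uniform in the forcing, which
  is needed because a change of the initial time is treated as a shift of \<open>f\<close>.
\<close>

lemma uniformly_dissipative:
  fixes a b h K :: real
  assumes "0 < h" and cond: "(a + b < 0 \<and> a * h \<le> 1) \<or> (b * h < - exp (a * h - 1) \<and> a * h \<ge> 1)"
    and "0 \<le> K"
  obtains R0 where "0 \<le> R0" "\<And>R. 0 \<le> R \<Longrightarrow> \<exists>t0\<ge>0. \<forall>f \<phi> u t. is_solution a b h f 0 \<phi> u \<longrightarrow>
      (\<forall>s. \<bar>f s\<bar> \<le> K) \<longrightarrow> (\<forall>s\<in>{-h..0}. \<bar>\<phi> s\<bar> \<le> R) \<longrightarrow> t0 \<le> t \<longrightarrow> \<bar>u t\<bar> \<le> R0"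
proof -
  have ab: "a + b < 0" by (rule delay_condition_imp_sum_neg [OF assms(1,2)])
  have "\<exists>R0. \<forall>R\<ge>0. \<exists>t0\<ge>0. \<forall>f \<phi> u t. is_solution a b h f 0 \<phi> u \<longrightarrow>
      (\<forall>s. \<bar>f s\<bar> \<le> K) \<longrightarrow> (\<forall>s\<in>{-h..0}. \<bar>\<phi> s\<bar> \<le> R) \<longrightarrow> t0 \<le> t \<longrightarrow> \<bar>u t\<bar> \<le> R0"
  proof (cases "b < 0")
    case True
    show ?thesis
      using dissipative_neg_delay [OF \<open>0 < h\<close> True ab \<open>0 \<le> K\<close> characteristic_gap [OF \<open>0 < h\<close> cond _ True]]
      by metis
  next
    case False
    then show ?thesis
      using dissipative_nonneg_delay [OF \<open>0 < h\<close> _ ab \<open>0 \<le> K\<close>]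
      by (intro exI [of _ "K / - (a + b) + 2"]) (metis linorder_not_less)
  qed
  then obtain R0 where R0: "\<And>R. 0 \<le> R \<Longrightarrow> \<exists>t0\<ge>0. \<forall>f \<phi> u t. is_solution a b h f 0 \<phi> u \<longrightarrow>
      (\<forall>s. \<bar>f s\<bar> \<le> K) \<longrightarrow> (\<forall>s\<in>{-h..0}. \<bar>\<phi> s\<bar> \<le> R) \<longrightarrow> t0 \<le> t \<longrightarrow> \<bar>u t\<bar> \<le> R0"
    by blast
  show thesis
  proof (rule that [of "max R0 0"])
    fix R :: real assume "0 \<le> R"
    from R0 [OF this] show "\<exists>t0\<ge>0. \<forall>f \<phi> u t. is_solution a b h f 0 \<phi> u \<longrightarrow>
      (\<forall>s. \<bar>f s\<bar> \<le> K) \<longrightarrow> (\<forall>s\<in>{-h..0}. \<bar>\<phi> s\<bar> \<le> R) \<longrightarrow> t0 \<le> t \<longrightarrow> \<bar>u t\<bar> \<le> max R0 0"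
      by (meson max.coboundedI1)
  qed simp
qed

section \<open>Existence of solutions\<close>

lemma continuous_on_window_sup:
  fixes u :: "real \<Rightarrow> real"
  assumes cont: "continuous_on UNIV u" and "0 \<le> h"
  shows "continuous_on UNIV (\<lambda>t. SUP s\<in>{t - h..t}. u s)"
proof -
  have "\<exists>d>0. \<forall>t'. dist t' t < d \<longrightarrow> dist (SUP s\<in>{t' - h..t'}. u s) (SUP s\<in>{t - h..t}. u s) < e"
    if "0 < e" for t e
  proof -
    have "uniformly_continuous_on {t - h - 1..t + 1} u"
      by (intro compact_uniformly_continuous continuous_on_subset [OF cont]) auto
    then obtain d where d: "0 < d"
      "\<And>x y. \<lbrakk>x \<in> {t - h - 1..t + 1}; y \<in> {t - h - 1..t + 1}; dist y x < d\<rbrakk> \<Longrightarrow> dist (u y) (u x) < e / 2"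
      unfolding uniformly_continuous_on_def using half_gt_zero [OF \<open>0 < e\<close>] by metis
    have "dist (SUP s\<in>{t' - h..t'}. u s) (SUP s\<in>{t - h..t}. u s) < e" if "dist t' t < min d 1" for t'
    proof -
      have "\<bar>(SUP s\<in>{t' - h..t'}. u s) - (SUP s\<in>{t - h..t}. u s)\<bar> \<le> e / 2"
      proof (rule window_sup_diff [OF _ _ \<open>0 \<le> h\<close>])
        show "\<bar>u (t' - s) - u (t - s)\<bar> \<le> e / 2" if "s \<in> {0..h}" for s
        proof -
          have "t' - s \<in> {t - h - 1..t + 1}" "t - s \<in> {t - h - 1..t + 1}"
            using \<open>dist t' t < min d 1\<close> that by (auto simp: dist_real_def abs_less_iff)
          then have "dist (u (t' - s)) (u (t - s)) < e / 2"
            using \<open>dist t' t < min d 1\<close> by (intro d(2)) (auto simp: dist_real_def)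
          then show ?thesis by (simp add: dist_real_def)
        qed
      qed (auto intro: continuous_on_subset [OF cont])
      then show ?thesis using \<open>0 < e\<close> by (simp add: dist_real_def)
    qed
    then show ?thesis using d(1) by (intro exI [of _ "min d 1"]) auto
  qed
  then show ?thesis unfolding continuous_on_iff by (auto simp: UNIV_I)
qed

text \<open>
  In the norm with weight \<open>exp (- L t)\<close>, integration has norm at most \<open>1 / L\<close>.
\<close>

lemma abs_integral_le_exp:
  fixes g :: "real \<Rightarrow> real"
  assumes cont: "continuous_on {0..t} g" and "0 < L" "0 \<le> t" "0 \<le> B"
    and le: "\<And>s. s \<in> {0..t} \<Longrightarrow> \<bar>g s\<bar> \<le> B * exp (L * s)"
  shows "\<bar>integral {0..t} g\<bar> \<le> B / L * exp (L * t)"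
proof -
  have "((\<lambda>s. B * exp (L * s)) has_integral (B / L * exp (L * t) - B / L * exp (L * 0))) {0..t}"
  proof (rule fundamental_theorem_of_calculus [OF \<open>0 \<le> t\<close>])
    show "((\<lambda>s. B / L * exp (L * s)) has_vector_derivative B * exp (L * s)) (at s within {0..t})" for s
      unfolding has_real_derivative_iff_has_vector_derivative [symmetric]
      by (rule derivative_eq_intros refl | use \<open>0 < L\<close> in simp)+
  qed
  then have "norm (integral {0..t} g) \<le> B / L * exp (L * t) - B / L * exp (L * 0)"
    using integral_norm_bound_integral [of g "{0..t}" "\<lambda>s. B * exp (L * s)"]
      integrable_continuous_real [OF cont] le
    by (auto simp: has_integral_integrable_integral)
  moreover have "0 \<le> B / L" using assms by simp
  ultimately show ?thesis by simp
qed

text \<open>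
  The right-hand side is Lipschitz in the weighted norm: the weight is increasing, so the window of
  the past counts no more than the present.
\<close>

lemma max_rhs_exp_diff:
  fixes w z :: "real \<Rightarrow> real"
  assumes "continuous_on UNIV w" "continuous_on UNIV z" "0 \<le> h" "0 \<le> L"
    and le: "\<And>s. \<bar>w s - z s\<bar> \<le> D"
  shows "\<bar>max_rhs a b h f (\<lambda>s. exp (L * s) * w s) t - max_rhs a b h f (\<lambda>s. exp (L * s) * z s) t\<bar>
    \<le> (\<bar>a\<bar> + \<bar>b\<bar>) * D * exp (L * t)"
proof -
  have D: "0 \<le> D" using le [of 0] by simp
  have diff: "\<bar>exp (L * s) * w s - exp (L * s) * z s\<bar> \<le> D * exp (L * t)" if "s \<le> t" for s
  proof -
    have "\<bar>exp (L * s) * w s - exp (L * s) * z s\<bar> = exp (L * s) * \<bar>w s - z s\<bar>"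
      by (simp add: abs_mult flip: right_diff_distrib)
    also have "\<dots> \<le> exp (L * t) * D" using that \<open>0 \<le> L\<close> le by (intro mult_mono) (auto intro: mult_left_mono)
    finally show ?thesis by (simp add: mult.commute)
  qed
  have "\<bar>(SUP s\<in>{t - h..t}. exp (L * s) * w s) - (SUP s\<in>{t - h..t}. exp (L * s) * z s)\<bar> \<le> D * exp (L * t)"
    using assms(1,2)
    by (intro window_sup_diff diff)
       (auto intro!: continuous_intros \<open>0 \<le> h\<close> intro: continuous_on_subset)
  then have "\<bar>b * ((SUP s\<in>{t - h..t}. exp (L * s) * w s) - (SUP s\<in>{t - h..t}. exp (L * s) * z s))\<bar>
      \<le> \<bar>b\<bar> * (D * exp (L * t))" by (simp add: abs_mult mult_left_mono)
  moreover have "\<bar>a * (exp (L * t) * w t - exp (L * t) * z t)\<bar> \<le> \<bar>a\<bar> * (D * exp (L * t))"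
    using diff [of t] by (simp add: abs_mult mult_left_mono)
  ultimately show ?thesis unfolding max_rhs_def by (simp add: algebra_simps)
qed

text \<open>
  With \<open>u t = exp (L t) w t\<close> the integral equation becomes a fixed point problem for a bounded
  continuous \<open>w\<close> on the whole line. As \<open>L > 2 (\<bar>a\<bar> + \<bar>b\<bar>)\<close>, the integral operator \<open>P\<close> is a
  contraction with constant \<open>1 / 2\<close>, so one application of Banach's theorem gives the solution
  for all times. The clamps to \<open>{-h..0}\<close> and \<open>{0..}\<close> only extend the functions to the whole line.
\<close>

lemma solution_0_exists:
  fixes a b h K :: real and f \<phi> :: "real \<Rightarrow> real"
  assumes "0 \<le> h" and cf: "continuous_on UNIV f" and K: "\<And>t. \<bar>f t\<bar> \<le> K"
    and c\<phi>: "continuous_on {-h..0} \<phi>"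
  shows "\<exists>u. is_solution a b h f 0 \<phi> u"
proof -
  define L where "L = 2 * (\<bar>a\<bar> + \<bar>b\<bar>) + 1"
  have L: "0 < L" "(\<bar>a\<bar> + \<bar>b\<bar>) / L \<le> 1 / 2" by (auto simp: L_def field_simps add_nonneg_pos)
  have "0 \<le> K" using K [of 0] by simp
  define hist where "hist t = \<phi> (max (-h) (min t 0))" for t
  define G where "G w t = max_rhs a b h f (\<lambda>s. exp (L * s) * w s) t" for w t
  define cl where "cl t = max (-h) t" for t
  define P where "P w t = exp (- L * cl t) * (hist t + integral {0..max t 0} (G w))" for w t
  have contG: "continuous_on UNIV (G w)" if "continuous_on UNIV w" for w
    unfolding G_def max_rhs_def
    by (intro continuous_intros continuous_on_window_sup cf that \<open>0 \<le> h\<close>)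
  have conthist: "continuous_on UNIV hist"
    unfolding hist_def
    by (rule continuous_on_compose2 [OF c\<phi>]) (use \<open>0 \<le> h\<close> in \<open>auto intro!: continuous_intros\<close>)
  obtain B where B: "\<And>t. \<bar>hist t\<bar> \<le> B"
  proof -
    have "bounded (\<phi> ` {-h..0})" using compact_continuous_image [OF c\<phi>] compact_imp_bounded by blast
    then obtain B where "\<forall>x\<in>{-h..0}. \<bar>\<phi> x\<bar> \<le> B" by (auto simp: bounded_iff)
    then have "\<bar>hist t\<bar> \<le> B" for t using \<open>0 \<le> h\<close> by (simp add: hist_def)
    then show thesis by (rule that)
  qed
  have derI: "((\<lambda>t. integral {0..t} (G w)) has_real_derivative G w t) (at t within {0..})"
    if "continuous_on UNIV w" "0 \<le> t" for w t
  proof -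
    have "((\<lambda>t. integral {0..t} (G w)) has_real_derivative G w t) (at t within {0..t + 1})"
      by (rule integral_has_real_derivative)
         (use that continuous_on_subset [OF contG [OF that(1)]] in auto)
    moreover have "at t within {0..t + 1} = at t within {0..}"
      by (rule at_within_nhd [of t "{..<t + 1}"]) auto
    ultimately show ?thesis by simp
  qed
  have contP: "continuous_on UNIV (P w)" if "continuous_on UNIV w" for w
  proof -
    have "continuous_on {0..} (\<lambda>t. integral {0..t} (G w))"
      by (rule continuous_on_halfline_if_deriv [OF derI [OF that]])
    then have "continuous_on UNIV (\<lambda>t. integral {0..max t 0} (G w))"
      by (rule continuous_on_compose2) (auto intro!: continuous_intros)
    then show ?thesis unfolding P_def cl_def
      by (intro continuous_intros conthist)
  qed
  have intb: "exp (- L * cl t) * \<bar>integral {0..max t 0} g\<bar> \<le> A / L"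
    if "continuous_on UNIV g" "0 \<le> A" "\<And>s. 0 \<le> s \<Longrightarrow> \<bar>g s\<bar> \<le> A * exp (L * s)" for g A t
  proof (cases "0 \<le> t")
    case False
    then have "integral {0..max t 0} g = 0" by (simp add: max_def)
    then show ?thesis using that(2) L by simp
  next
    case True
    then have "\<bar>integral {0..t} g\<bar> \<le> A / L * exp (L * t)"
      by (intro abs_integral_le_exp) (use that L in \<open>auto intro: continuous_on_subset\<close>)
    then have "exp (- L * t) * \<bar>integral {0..t} g\<bar> \<le> exp (- L * t) * (A / L * exp (L * t))"
      by (intro mult_left_mono) auto
    also have "\<dots> = A / L" by (simp add: exp_minus field_simps)
    finally show ?thesis using True \<open>0 \<le> h\<close> by (simp add: cl_def max_def)
  qed
  have bdP: "\<bar>P w t\<bar> \<le> exp (L * h) * B + ((\<bar>a\<bar> + \<bar>b\<bar>) * D + K) / L"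
    if w: "continuous_on UNIV w" "\<And>s. \<bar>w s\<bar> \<le> D" for w D t
  proof -
    have D: "0 \<le> D" using w(2) [of 0] by simp
    have Gb: "\<bar>G w s\<bar> \<le> ((\<bar>a\<bar> + \<bar>b\<bar>) * D + K) * exp (L * s)" if "0 \<le> s" for s
    proof -
      have "\<bar>G w s - G (\<lambda>_. 0) s\<bar> \<le> (\<bar>a\<bar> + \<bar>b\<bar>) * D * exp (L * s)"
        unfolding G_def by (rule max_rhs_exp_diff) (use w L \<open>0 \<le> h\<close> in auto)
      moreover have "G (\<lambda>_. 0) s = f s" using \<open>0 \<le> h\<close> by (simp add: G_def max_rhs_def)
      moreover have "K * 1 \<le> K * exp (L * s)" using \<open>0 \<le> K\<close> L that by (intro mult_left_mono) auto
      ultimately show ?thesis using K [of s] by (simp add: algebra_simps)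
    qed
    have "L * - cl t \<le> L * h" using L(1) by (intro mult_left_mono) (auto simp: cl_def)
    then have "exp (- L * cl t) * \<bar>hist t\<bar> \<le> exp (L * h) * B"
      using B [of t] by (intro mult_mono) auto
    moreover have "exp (- L * cl t) * \<bar>integral {0..max t 0} (G w)\<bar> \<le> ((\<bar>a\<bar> + \<bar>b\<bar>) * D + K) / L"
      by (rule intb [OF contG [OF w(1)] _ Gb]) (use D \<open>0 \<le> K\<close> in auto)
    moreover have "\<bar>P w t\<bar> \<le> exp (- L * cl t) * \<bar>hist t\<bar> + exp (- L * cl t) * \<bar>integral {0..max t 0} (G w)\<bar>"
      unfolding P_def abs_mult abs_exp_cancel distrib_left [symmetric]
      by (intro mult_left_mono abs_triangle_ineq) auto
    ultimately show ?thesis by linarith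
  qed
  define Q :: "(real \<Rightarrow>\<^sub>C real) \<Rightarrow> (real \<Rightarrow>\<^sub>C real)" where "Q w = Bcontfun (P (apply_bcontfun w))" for w
  have wb: "\<bar>apply_bcontfun w s\<bar> \<le> norm w" for w :: "real \<Rightarrow>\<^sub>C real" and s
    using norm_bounded [of w s] by simp
  have cw: "continuous_on UNIV (apply_bcontfun w)" for w :: "real \<Rightarrow>\<^sub>C real" by simp
  have Q: "apply_bcontfun (Q w) = P (apply_bcontfun w)" for w
    unfolding Q_def
    by (intro Bcontfun_inverse bcontfun_normI contP cw) (use bdP [OF cw wb] in auto)
  have "\<exists>!w. Q w = w"
  proof (rule banach_fix_type [where c = "1 / 2"])
    show "\<forall>w z. dist (Q w) (Q z) \<le> 1 / 2 * dist w z"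
    proof (intro allI dist_bound)
      fix w z :: "real \<Rightarrow>\<^sub>C real" and t
      have d: "\<bar>apply_bcontfun w s - apply_bcontfun z s\<bar> \<le> dist w z" for s
        using dist_bounded [of w s z] by (simp add: dist_real_def)
      have iG: "G (apply_bcontfun w) integrable_on {0..max t 0}" "G (apply_bcontfun z) integrable_on {0..max t 0}"
        by (intro integrable_continuous_real continuous_on_subset [OF contG [OF cw]] subset_UNIV)+
      have "P w t - P z t = exp (- L * cl t) * integral {0..max t 0} (\<lambda>s. G w s - G z s)"
        by (simp add: P_def algebra_simps Henstock_Kurzweil_Integration.integral_diff [OF iG])
      then have "\<bar>P w t - P z t\<bar> = exp (- L * cl t) * \<bar>integral {0..max t 0} (\<lambda>s. G w s - G z s)\<bar>"
        by (simp add: abs_mult)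
      also have "\<dots> \<le> (\<bar>a\<bar> + \<bar>b\<bar>) * dist w z / L"
      proof (rule intb)
        show "continuous_on UNIV (\<lambda>s. G w s - G z s)" by (intro continuous_on_diff contG cw)
        show "\<bar>G w s - G z s\<bar> \<le> (\<bar>a\<bar> + \<bar>b\<bar>) * dist w z * exp (L * s)" for s
          unfolding G_def by (rule max_rhs_exp_diff) (use d L \<open>0 \<le> h\<close> in auto)
      qed simp
      also have "\<dots> \<le> 1 / 2 * dist w z"
        using mult_right_mono [OF L(2), of "dist w z"] by simp
      finally show "dist (apply_bcontfun (Q w) t) (apply_bcontfun (Q z) t) \<le> 1 / 2 * dist w z"
        by (simp add: Q dist_real_def)
    qed
  qed auto
  then obtain w where "Q w = w" by blast
  then have fp: "P (apply_bcontfun w) t = apply_bcontfun w t" for t using Q [of w] by simp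
  define u where "u t = exp (L * t) * apply_bcontfun w t" for t
  have u: "u t = hist t + integral {0..max t 0} (G w)" if "-h \<le> t" for t
  proof -
    have "u t = exp (L * t) * (exp (- L * t) * (hist t + integral {0..max t 0} (G w)))"
      using fp [of t] that by (simp add: u_def P_def cl_def max_def)
    then show ?thesis by (simp add: exp_minus)
  qed
  have "is_solution a b h f 0 \<phi> u"
    unfolding is_solution_def
  proof (intro conjI allI impI ballI)
    show "continuous_on {0 - h..} u" unfolding u_def by (intro continuous_intros) auto
    show "u (0 + s) = \<phi> s" if "s \<in> {-h..0}" for s
      using u [of s] that by (simp add: hist_def max_def min_def)
    fix t :: real assume "0 \<le> t"
    have "((\<lambda>t. \<phi> 0 + integral {0..t} (G w)) has_real_derivative G w t) (at t within {0..})"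
      using derI [OF cw \<open>0 \<le> t\<close>, of w] by (auto intro!: derivative_eq_intros)
    moreover have "u s = \<phi> 0 + integral {0..s} (G w)" if "s \<in> {0..}" for s
      using u [of s] that \<open>0 \<le> h\<close> by (simp add: hist_def max_def min_def)
    ultimately have "(u has_real_derivative G w t) (at t within {0..})"
      using \<open>0 \<le> t\<close> by (auto elim: has_field_derivative_transform_within [OF _ zero_less_one])
    moreover have "G w t = a * u t + b * (SUP s\<in>{t - h..t}. u s) + f t"
      by (simp add: G_def max_rhs_def u_def)
    ultimately show "(u has_real_derivative a * u t + b * (SUP s\<in>{t - h..t}. u s) + f t) (at t within {0..})"
      by simp
  qed
  then show ?thesis by blast
qed

section \<open>The phase space\<close>

definition circle_embed :: "real \<Rightarrow> real \<Rightarrow> real \<times> real" where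
  "circle_embed T t = (cos (2 * pi * t / T), sin (2 * pi * t / T))"

lemma circle_embed_add_period:
  assumes "0 < T"
  shows "circle_embed T (t + of_int k * T) = circle_embed T t"
proof -
  have eq: "2 * pi * (t + of_int k * T) / T = 2 * pi * t / T + 2 * pi * of_int k"
    using assms by (simp add: field_simps)
  then show ?thesis
    using sin_cos_eq_iff [of "2 * pi * (t + of_int k * T) / T" "2 * pi * t / T"]
    unfolding circle_embed_def by auto
qed

lemma inj_on_circle_embed:
  assumes "0 < T"
  shows "inj_on (circle_embed T) {0..<T}"
proof (rule inj_onI)
  fix s t assume s: "s \<in> {0..<T}" and t: "t \<in> {0..<T}" and "circle_embed T s = circle_embed T t"
  then obtain k :: int where k: "2 * pi * s / T = 2 * pi * t / T + 2 * pi * of_int k"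
    using sin_cos_eq_iff [of "2 * pi * s / T" "2 * pi * t / T"] unfolding circle_embed_def by auto
  then have "2 * pi * (s - t) = 2 * pi * (of_int k * T)" using assms by (simp add: field_simps)
  then have st: "s - t = of_int k * T" by simp
  then have "\<bar>of_int k * T\<bar> < 1 * T" using s t by auto
  then have "\<bar>of_int k :: real\<bar> < 1" using assms by (simp add: abs_mult)
  then have "k = 0" by linarith
  then show "s = t" using st by simp
qed

lemma rmod_eq_add_period: "\<exists>k::int. t = t rmod T + of_int k * T"
proof (cases "0 \<le> T")
  case True then show ?thesis by (intro exI [of _ "\<lfloor>t / \<bar>T\<bar>\<rfloor>"]) (simp add: rmod_def)
next
  case False then show ?thesis by (intro exI [of _ "- \<lfloor>t / \<bar>T\<bar>\<rfloor>"]) (simp add: rmod_def)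
qed

lemma continuous_map_circle_embed:
  assumes "0 < T"
  shows "continuous_map (circle_topology T) euclidean (circle_embed T)"
proof (rule continuous_compose_quotient_map [OF quotient_map_circle_proj [OF assms]])
  have "continuous_on {0..T} (circle_embed T)"
    unfolding circle_embed_def using assms by (intro continuous_intros) auto
  moreover have "(circle_embed T \<circ> circle_proj T) t = circle_embed T t" for t
    using circle_embed_add_period [OF assms, of 0 1] by (simp add: circle_proj_def)
  ultimately show "continuous_map (top_of_set {0..T}) euclidean (circle_embed T \<circ> circle_proj T)"
    by (simp add: o_def)
qed

lemma Hausdorff_space_circle_topology:
  assumes "0 < T"
  shows "Hausdorff_space (circle_topology T)"
  by (rule Hausdorff_space_injective_preimage [OF _ continuous_map_circle_embed [OF assms]])
     (use inj_on_circle_embed [OF assms] in \<open>simp_all add: topspace_circle_topology assms\<close>)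

lemma compact_space_circle_topology:
  assumes "0 < T"
  shows "compact_space (circle_topology T)"
proof -
  have "compactin (top_of_set {0..T}) {0..T}" by (simp add: compactin_subtopology)
  then have "compactin (circle_topology T) (circle_proj T ` {0..T})"
    by (rule image_compactin [OF _ quotient_imp_continuous_map [OF quotient_map_circle_proj [OF assms]]])
  then show ?thesis
    using quotient_imp_surjective_map [OF quotient_map_circle_proj [OF assms]]
    by (simp add: compact_space_def)
qed

text \<open>
  The embedding of the circle into the plane is a homeomorphism onto its image by compactness. Reduction
  modulo \<open>T\<close> is the winding of the line around the circle followed by the inverse of this embedding.
\<close>

lemma continuous_map_rmod:
  assumes "0 < T"
  shows "continuous_map euclidean (circle_topology T) (\<lambda>t. t rmod T)"
proof -
  let ?Y = "top_of_set (circle_embed T ` {0..<T})"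
  note top = topspace_circle_topology [OF assms]
  have "homeomorphic_map (circle_topology T) ?Y (circle_embed T)"
  proof (rule continuous_imp_homeomorphic_map)
    show "continuous_map (circle_topology T) ?Y (circle_embed T)"
      using continuous_map_circle_embed [OF assms] by (simp add: continuous_map_in_subtopology top)
  qed (use compact_space_circle_topology [OF assms] inj_on_circle_embed [OF assms]
       in \<open>auto simp: top Hausdorff_space_subtopology\<close>)
  then obtain g where g: "homeomorphic_maps (circle_topology T) ?Y (circle_embed T) g"
    unfolding homeomorphic_map_maps by blast
  have r: "t rmod T \<in> {0..<T}" for t using assms by (simp add: rmod_nonneg rmod_less)
  have e: "circle_embed T t = circle_embed T (t rmod T)" for t
    using rmod_eq_add_period [of t T] circle_embed_add_period [OF assms] by metis
  have "continuous_on UNIV (circle_embed T)"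
    unfolding circle_embed_def using assms by (intro continuous_intros) auto
  then have "continuous_map euclidean ?Y (circle_embed T)"
    unfolding continuous_map_in_subtopology using imageI [OF r, of "circle_embed T"] e by auto
  then have "continuous_map euclidean (circle_topology T) (g \<circ> circle_embed T)"
    using g unfolding homeomorphic_maps_def by (blast intro: continuous_map_compose)
  moreover have "(g \<circ> circle_embed T) t = t rmod T" for t
    using g r [of t] e [of t] by (simp add: homeomorphic_maps_def top)
  ultimately show ?thesis by (metis (no_types, lifting) ext)
qed

lemma mdist_history_space_le:
  assumes "0 \<le> h" "\<phi> \<in> mspace (history_space h)" "\<psi> \<in> mspace (history_space h)"
  shows "mdist (history_space h) \<phi> \<psi> \<le> c \<longleftrightarrow> (\<forall>s\<in>{-h..0}. \<bar>\<phi> s - \<psi> s\<bar> \<le> c)"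
  using assms cfunspace_mdist_le [of \<phi> "top_of_set {-h..0}" euclidean_metric \<psi> c]
  unfolding history_space_def by (simp add: dist_real_def)

lemma Metric_space_history: "Metric_space (mspace (history_space h)) (mdist (history_space h))"
  by (rule Metric_space_mspace_mdist)

lemma Hausdorff_space_phase_space:
  assumes "0 < T"
  shows "Hausdorff_space (phase_space T h)"
  unfolding phase_space_def Hausdorff_space_prod_topology mtopology_of_def
  using Hausdorff_space_circle_topology [OF assms]
    Metric_space.Hausdorff_space_mtopology [OF Metric_space_history] by blast

lemma topspace_phase_space:
  assumes "0 < T"
  shows "topspace (phase_space T h) = {0..<T} \<times> mspace (history_space h)"
  by (simp add: phase_space_def topspace_circle_topology assms)

text \<open>
  The product of a quotient map with an identity need not be a quotient map, but the
  projection onto the circle is proper, and proper maps are stable under products. This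
  allows continuity on the phase space to be checked for initial times in the interval \<open>{0..T}\<close>.
\<close>

lemma quotient_map_phase_space:
  assumes "0 < T"
  shows "quotient_map (prod_topology (top_of_set {0..T}) (mtopology_of (history_space h)))
    (phase_space T h) (\<lambda>(t, \<phi>). (circle_proj T t, \<phi>))"
proof (rule continuous_closed_imp_quotient_map)
  let ?H = "mtopology_of (history_space h)"
  note q = quotient_map_circle_proj [OF assms]
  have c: "continuous_map (top_of_set {0..T}) (circle_topology T) (circle_proj T)"
    using quotient_imp_continuous_map q by blast
  have "proper_map (top_of_set {0..T}) (circle_topology T) (circle_proj T)"
    by (rule continuous_imp_proper_map [OF _ _ c])
       (simp_all add: compact_space_subtopology Hausdorff_imp_kc_space Hausdorff_space_circle_topology assms)
  then have "proper_map (prod_topology (top_of_set {0..T}) ?H) (phase_space T h) (\<lambda>(t, \<phi>). (circle_proj T t, id \<phi>))"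
    unfolding phase_space_def proper_map_prod using proper_map_id by blast
  then show "closed_map (prod_topology (top_of_set {0..T}) ?H) (phase_space T h) (\<lambda>(t, \<phi>). (circle_proj T t, \<phi>))"
    using proper_imp_closed_map by auto
  show "continuous_map (prod_topology (top_of_set {0..T}) ?H) (phase_space T h) (\<lambda>(t, \<phi>). (circle_proj T t, \<phi>))"
    unfolding phase_space_def continuous_map_pairwise o_def case_prod_unfold
    by (simp add: continuous_map_snd continuous_map_compose [OF continuous_map_fst c, unfolded o_def])
  show "(\<lambda>(t, \<phi>). (circle_proj T t, \<phi>)) ` topspace (prod_topology (top_of_set {0..T}) ?H) = topspace (phase_space T h)"
  proof -
    have "(\<lambda>(t, \<phi>). (circle_proj T t, \<phi>)) ` (A \<times> M) = circle_proj T ` A \<times> M" for A and M :: "(real \<Rightarrow> real) set" by auto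
    then show ?thesis
      using quotient_imp_surjective_map [OF q] by (simp add: phase_space_def)
  qed
qed

definition lipschitz_ball :: "real \<Rightarrow> real \<Rightarrow> real \<Rightarrow> (real \<Rightarrow> real) set" where
  "lipschitz_ball h R L = {\<phi> \<in> mspace (history_space h). (\<forall>s\<in>{-h..0}. \<bar>\<phi> s\<bar> \<le> R) \<and>
     (\<forall>s\<in>{-h..0}. \<forall>t\<in>{-h..0}. \<bar>\<phi> s - \<phi> t\<bar> \<le> L * \<bar>s - t\<bar>)}"

lemma lipschitz_ballI:
  assumes "0 \<le> L" "\<phi> \<in> extensional {-h..0}" "\<And>s. s \<in> {-h..0} \<Longrightarrow> \<bar>\<phi> s\<bar> \<le> R"
    "\<And>s t. \<lbrakk>s \<in> {-h..0}; t \<in> {-h..0}\<rbrakk> \<Longrightarrow> \<bar>\<phi> s - \<phi> t\<bar> \<le> L * \<bar>s - t\<bar>"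
  shows "\<phi> \<in> lipschitz_ball h R L"
proof -
  have "L-lipschitz_on {-h..0} \<phi>"
    by (rule lipschitz_onI) (use assms in \<open>auto simp: dist_real_def\<close>)
  then have "continuous_on {-h..0} \<phi>" by (rule lipschitz_on_continuous_on)
  then show ?thesis using assms by (simp add: lipschitz_ball_def mspace_history_space)
qed

lemma lipschitz_ball_subset: "lipschitz_ball h R L \<subseteq> mspace (history_space h)"
  by (auto simp: lipschitz_ball_def)

text \<open>
  Arzela and Ascoli: the bounds on the values and the Lipschitz constant pass to the uniform limit.
\<close>

lemma compactin_lipschitz_ball:
  assumes "0 \<le> h" "0 \<le> L"
  shows "compactin (mtopology_of (history_space h)) (lipschitz_ball h R L)"
  unfolding mtopology_of_def Metric_space.compactin_sequentially [OF Metric_space_history]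
proof (intro conjI allI impI lipschitz_ball_subset)
  fix \<sigma> :: "nat \<Rightarrow> real \<Rightarrow> real" assume "range \<sigma> \<subseteq> lipschitz_ball h R L"
  then have \<sigma>: "\<sigma> n \<in> lipschitz_ball h R L" for n by auto
  have bd: "\<bar>\<sigma> n s\<bar> \<le> R" if "s \<in> {-h..0}" for n s
    using \<sigma> [of n] that by (simp add: lipschitz_ball_def)
  have lip: "\<bar>\<sigma> n s - \<sigma> n t\<bar> \<le> L * \<bar>s - t\<bar>" if "s \<in> {-h..0}" "t \<in> {-h..0}" for n s t
    using \<sigma> [of n] that by (simp add: lipschitz_ball_def)
  obtain g k where g: "continuous_on {-h..0} g" and k: "strict_mono (k :: nat \<Rightarrow> nat)"
    and lim: "\<And>e. 0 < e \<Longrightarrow> \<exists>N. \<forall>n x. n \<ge> N \<and> x \<in> {-h..0} \<longrightarrow> norm (\<sigma> (k n) x - g x) < e"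
  proof (rule Arzela_Ascoli [of "{-h..0}" \<sigma> R])
    fix x e :: real assume x: "x \<in> {-h..0}" and e: "0 < e"
    show "\<exists>d>0. \<forall>n y. y \<in> {-h..0} \<and> norm (x - y) < d \<longrightarrow> norm (\<sigma> n x - \<sigma> n y) < e"
    proof (intro exI conjI allI impI)
      show "0 < e / (L + 1)" using e \<open>0 \<le> L\<close> by simp
      fix n y assume y: "y \<in> {-h..0} \<and> norm (x - y) < e / (L + 1)"
      then have "(L + 1) * \<bar>x - y\<bar> < e" using \<open>0 \<le> L\<close> by (simp add: field_simps)
      then show "norm (\<sigma> n x - \<sigma> n y) < e" using lip [of x y n] x y by (simp add: algebra_simps)
    qed
  qed (use bd in auto)
  have pt: "(\<lambda>n. \<sigma> (k n) x) \<longlonglongrightarrow> g x" if "x \<in> {-h..0}" for x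
    using lim that unfolding LIMSEQ_iff by blast
  define l where "l = restrict g {-h..0}"
  have l: "l \<in> lipschitz_ball h R L"
  proof (rule lipschitz_ballI [OF \<open>0 \<le> L\<close>])
    show "l \<in> extensional {-h..0}" by (simp add: l_def)
    show "\<bar>l s\<bar> \<le> R" if "s \<in> {-h..0}" for s
      using LIMSEQ_le_const2 [OF tendsto_rabs [OF pt [OF that]]] bd [OF that] that by (auto simp: l_def)
    show "\<bar>l s - l t\<bar> \<le> L * \<bar>s - t\<bar>" if "s \<in> {-h..0}" "t \<in> {-h..0}" for s t
      using LIMSEQ_le_const2 [OF tendsto_rabs [OF tendsto_diff [OF pt [OF that(1)] pt [OF that(2)]]]]
        lip [OF that] that by (auto simp: l_def)
  qed
  have "limitin (mtopology_of (history_space h)) (\<sigma> \<circ> k) l sequentially"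
    unfolding mtopology_of_def Metric_space.limit_metric_sequentially [OF Metric_space_history]
  proof (intro conjI allI impI)
    show lM: "l \<in> mspace (history_space h)" using l lipschitz_ball_subset by blast
    fix e :: real assume "0 < e"
    obtain N where N: "\<And>n x. \<lbrakk>N \<le> n; x \<in> {-h..0}\<rbrakk> \<Longrightarrow> norm (\<sigma> (k n) x - g x) < e / 2"
      using lim [of "e / 2"] \<open>0 < e\<close> by auto
    have M: "\<sigma> n \<in> mspace (history_space h)" for n using \<sigma> lipschitz_ball_subset by blast
    have "mdist (history_space h) (\<sigma> (k n)) l \<le> e / 2" if "N \<le> n" for n
      unfolding mdist_history_space_le [OF \<open>0 \<le> h\<close> M lM]
      using N [OF that] by (auto simp: l_def less_imp_le)
    then show "\<exists>N. \<forall>n\<ge>N. (\<sigma> \<circ> k) n \<in> mspace (history_space h) \<and> mdist (history_space h) ((\<sigma> \<circ> k) n) l < e"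
      using M \<open>0 < e\<close> by (intro exI [of _ N]) force
  qed
  then show "\<exists>l r. l \<in> lipschitz_ball h R L \<and> strict_mono r \<and>
      limitin (Metric_space.mtopology (mspace (history_space h)) (mdist (history_space h))) (\<sigma> \<circ> r) l sequentially"
    using l k unfolding mtopology_of_def by blast
qed

text \<open>
  The set is star-shaped around \<open>0\<close>: it is the union of the segments from \<open>0\<close> to its elements.
\<close>

lemma connectedin_lipschitz_ball:
  assumes "0 \<le> h" "0 \<le> R" "0 \<le> L"
  shows "connectedin (mtopology_of (history_space h)) (lipschitz_ball h R L)"
proof -
  let ?H = "mtopology_of (history_space h)"
  define P where "P \<phi> r = restrict (\<lambda>s. r * \<phi> s) {-h..0}" for \<phi> :: "real \<Rightarrow> real" and r
  have sub: "P \<phi> r \<in> lipschitz_ball h R L" if \<phi>: "\<phi> \<in> lipschitz_ball h R L" and r: "r \<in> {0..1}" for \<phi> r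
  proof (rule lipschitz_ballI [OF \<open>0 \<le> L\<close>])
    show "P \<phi> r \<in> extensional {-h..0}" by (simp add: P_def)
    show "\<bar>P \<phi> r s\<bar> \<le> R" if "s \<in> {-h..0}" for s
      using mult_mono [of r 1 "\<bar>\<phi> s\<bar>" R] r \<phi> that by (simp add: P_def abs_mult lipschitz_ball_def)
    show "\<bar>P \<phi> r s - P \<phi> r t\<bar> \<le> L * \<bar>s - t\<bar>" if "s \<in> {-h..0}" "t \<in> {-h..0}" for s t
    proof -
      have "\<bar>P \<phi> r s - P \<phi> r t\<bar> = r * \<bar>\<phi> s - \<phi> t\<bar>"
        using that r by (simp add: P_def abs_mult flip: right_diff_distrib)
      also have "\<dots> \<le> 1 * (L * \<bar>s - t\<bar>)"
        using r \<phi> that by (intro mult_mono) (auto simp: lipschitz_ball_def)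
      finally show ?thesis by simp
    qed
  qed
  have conn: "connectedin ?H (P \<phi> ` {0..1})" if \<phi>: "\<phi> \<in> lipschitz_ball h R L" for \<phi>
  proof (rule connectedin_continuous_map_image)
    show "connectedin (top_of_set {0..1::real}) {0..1}" by (simp add: connectedin_subtopology)
    show "continuous_map (top_of_set {0..1}) ?H (P \<phi>)"
      unfolding mtopology_of_def Metric_space.continuous_map_to_metric [OF Metric_space_history]
    proof (intro ballI allI impI)
      fix r e :: real assume r: "r \<in> topspace (top_of_set {0..1})" and e: "0 < e"
      define U where "U = {0..1} \<inter> ball r (e / (2 * (R + 1)))"
      have M: "P \<phi> x \<in> mspace (history_space h)" if "x \<in> {0..1}" for x
        using sub [OF \<phi> that] lipschitz_ball_subset by blast
      have "P \<phi> x \<in> Metric_space.mball (mspace (history_space h)) (mdist (history_space h)) (P \<phi> r) e"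
        if x: "x \<in> U" for x
      proof -
        have x01: "x \<in> {0..1}" "r \<in> {0..1}" using x r by (auto simp: U_def)
        have "\<bar>r - x\<bar> * (2 * (R + 1)) < e" using x \<open>0 \<le> R\<close> by (simp add: U_def dist_real_def field_simps)
        then have rx: "\<bar>r - x\<bar> * (R + 1) \<le> e / 2" by (simp add: algebra_simps)
        have "\<bar>P \<phi> r s - P \<phi> x s\<bar> \<le> e / 2" if "s \<in> {-h..0}" for s
        proof -
          have "\<bar>P \<phi> r s - P \<phi> x s\<bar> = \<bar>r - x\<bar> * \<bar>\<phi> s\<bar>"
            using that by (simp add: P_def flip: left_diff_distrib abs_mult)
          also have "\<dots> \<le> \<bar>r - x\<bar> * (R + 1)"
            using \<phi> that by (intro mult_left_mono) (force simp: lipschitz_ball_def)+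
          finally show ?thesis using rx by simp
        qed
        then have "mdist (history_space h) (P \<phi> r) (P \<phi> x) \<le> e / 2"
          using mdist_history_space_le [OF \<open>0 \<le> h\<close> M M] x01 by blast
        then show ?thesis
          using M x01 e by (simp add: Metric_space.in_mball [OF Metric_space_history])
      qed
      moreover have "openin (top_of_set {0..1}) U" unfolding U_def by (simp add: openin_open_Int)
      moreover have "r \<in> U" using r e \<open>0 \<le> R\<close> by (simp add: U_def)
      ultimately show "\<exists>U. openin (top_of_set {0..1}) U \<and> r \<in> U \<and>
          (\<forall>y\<in>U. P \<phi> y \<in> Metric_space.mball (mspace (history_space h)) (mdist (history_space h)) (P \<phi> r) e)"
        by blast
    qed
  qed
  have P0: "P \<phi> 0 = P (\<lambda>_. 0) 0" for \<phi> by (auto simp: P_def)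
  have P1: "P \<phi> 1 = \<phi>" if "\<phi> \<in> lipschitz_ball h R L" for \<phi>
    using that by (auto simp: P_def lipschitz_ball_def mspace_history_space extensional_restrict)
  have "lipschitz_ball h R L = \<Union> ((\<lambda>\<phi>. P \<phi> ` {0..1}) ` lipschitz_ball h R L)"
  proof
    show "lipschitz_ball h R L \<subseteq> \<Union> ((\<lambda>\<phi>. P \<phi> ` {0..1}) ` lipschitz_ball h R L)"
    proof
      fix \<phi> assume "\<phi> \<in> lipschitz_ball h R L"
      then show "\<phi> \<in> \<Union> ((\<lambda>\<phi>. P \<phi> ` {0..1}) ` lipschitz_ball h R L)"
        using P1 [of \<phi>] image_eqI [of \<phi> "P \<phi>" 1 "{0..1}"] by auto
    qed
  qed (use sub in auto)
  moreover have "connectedin ?H (\<Union> ((\<lambda>\<phi>. P \<phi> ` {0..1}) ` lipschitz_ball h R L))"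
  proof (cases "lipschitz_ball h R L = {}")
    case False
    show ?thesis
    proof (rule connectedin_Union)
      have "P (\<lambda>_. 0) 0 \<in> \<Inter> ((\<lambda>\<phi>. P \<phi> ` {0..1}) ` lipschitz_ball h R L)"
        using P0 by (metis (no_types, lifting) INT_I atLeastAtMost_iff image_eqI order_refl zero_le_one)
      then show "\<Inter> ((\<lambda>\<phi>. P \<phi> ` {0..1}) ` lipschitz_ball h R L) \<noteq> {}" by blast
    qed (use conn in auto)
  qed simp
  ultimately show ?thesis by simp
qed

lemma zero_in_lipschitz_ball:
  assumes "0 \<le> R" "0 \<le> L"
  shows "restrict (\<lambda>_. 0) {-h..0} \<in> lipschitz_ball h R L"
  by (rule lipschitz_ballI) (use assms in auto)

lemma connectedin_circle_topology:
  assumes "0 < T"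
  shows "connectedin (circle_topology T) {0..<T}"
proof -
  have "connectedin (circle_topology T) (circle_proj T ` {0..T})"
    by (rule connectedin_continuous_map_image
          [OF quotient_imp_continuous_map [OF quotient_map_circle_proj [OF assms]]])
       (simp add: connectedin_subtopology)
  then show ?thesis
    using quotient_imp_surjective_map [OF quotient_map_circle_proj [OF assms]]
    by (simp add: topspace_circle_topology assms)
qed

section \<open>The semiflow and its attractor\<close>

definition history_segment :: "real \<Rightarrow> (real \<Rightarrow> real) \<Rightarrow> real \<Rightarrow> real \<Rightarrow> real" where
  "history_segment h u t = restrict (\<lambda>s. u (t + s)) {-h..0}"

lemma history_segment_in_mspace:
  assumes "continuous_on {t - h..t} u"
  shows "history_segment h u t \<in> mspace (history_space h)"
proof -
  have "continuous_on {-h..0} (\<lambda>s. u (t + s))"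
    by (rule continuous_on_compose2 [OF assms]) (auto intro!: continuous_intros)
  then have "continuous_on {-h..0} (history_segment h u t)"
    by (rule continuous_on_eq) (simp add: history_segment_def)
  then show ?thesis by (simp add: mspace_history_space history_segment_def)
qed

lemma is_solution_shift:
  assumes "is_solution a b h f \<tau> \<phi> u"
  shows "is_solution a b h (\<lambda>t. f (t + c)) (\<tau> - c) \<phi> (\<lambda>t. u (t + c))"
  unfolding is_solution_def
proof (intro conjI ballI allI impI)
  have "continuous_on {\<tau> - h..} u" using assms by (simp add: is_solution_def)
  then show "continuous_on {\<tau> - c - h..} (\<lambda>t. u (t + c))"
    by (rule continuous_on_compose2) (auto intro!: continuous_intros)
  show "u (\<tau> - c + s + c) = \<phi> s" if "s \<in> {-h..0}" for s
    using assms that by (simp add: is_solution_def)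
  fix t assume "\<tau> - c \<le> t"
  then have "(u has_real_derivative (a * u (t + c) + b * (SUP s\<in>{t + c - h..t + c}. u s) + f (t + c)))
      (at (t + c) within {\<tau>..})" using assms by (simp add: is_solution_def)
  moreover have "(+) c ` {\<tau> - c..} = {\<tau>..}"
    by (auto simp: image_iff intro: exI [of _ "_ - c"] bexI [of _ "_ - c"])
  ultimately have "((\<lambda>t. u (c + t)) has_real_derivative
      (a * u (t + c) + b * (SUP s\<in>{t + c - h..t + c}. u s) + f (t + c))) (at t within {\<tau> - c..})"
    by (intro iffD1 [OF DERIV_at_within_shift]) (simp add: add.commute [of c])
  moreover have "(SUP s\<in>{t + c - h..t + c}. u s) = (SUP s\<in>{t - h..t}. u (s + c))"
  proof -
    have "{t + c - h..t + c} = (\<lambda>s. s + c) ` {t - h..t}"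
      unfolding image_add_atLeastAtMost' by (simp add: algebra_simps)
    then show ?thesis by (simp only: image_image)
  qed
  ultimately show "((\<lambda>t. u (t + c)) has_real_derivative
      (a * u (t + c) + b * (SUP s\<in>{t - h..t}. u (s + c)) + f (t + c))) (at t within {\<tau> - c..})"
    by (simp add: add.commute)
qed

text \<open>
  A change of the initial time is a translation of the forcing. All estimates are therefore
  needed only for the initial time \<open>0\<close>, uniformly over translates of \<open>f\<close>.
\<close>

lemma is_solution_shift_to_0:
  assumes "is_solution a b h f \<tau> \<phi> u"
  shows "is_solution a b h (\<lambda>t. f (t + \<tau>)) 0 \<phi> (\<lambda>t. u (t + \<tau>))"
  using is_solution_shift [OF assms, of \<tau>] by simp

lemma is_solution_unique:
  assumes u: "is_solution a b h f \<tau> \<phi> u" and v: "is_solution a b h f \<tau> \<phi> v"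
    and "0 \<le> h" "\<tau> - h \<le> t"
  shows "u t = v t"
proof (cases "\<tau> \<le> t")
  case False
  then have "t - \<tau> \<in> {-h..0}" using \<open>\<tau> - h \<le> t\<close> by auto
  then have "u (\<tau> + (t - \<tau>)) = v (\<tau> + (t - \<tau>))" using u v unfolding is_solution_def by metis
  then show ?thesis by simp
next
  case True
  define m where "m = exp ((\<bar>a\<bar> + \<bar>b\<bar> + 1) * (t - \<tau>))"
  have "\<bar>u t - v t\<bar> \<le> 0 + e" if "0 < e" for e
  proof -
    have "\<bar>u (t - \<tau> + \<tau>) - v (t - \<tau> + \<tau>)\<bar> \<le> e / m * m" unfolding m_def
      by (rule solution_difference_bound [OF is_solution_shift_to_0 [OF u] is_solution_shift_to_0 [OF v],
            where T = "t - \<tau>"])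
         (use \<open>0 \<le> h\<close> \<open>0 < e\<close> True in auto)
    then show ?thesis by (simp add: m_def)
  qed
  then have "\<bar>u t - v t\<bar> \<le> 0" by (rule field_le_epsilon)
  then show ?thesis by simp
qed

lemma is_solution_cong:
  assumes u: "is_solution a b h f \<tau> \<phi> u" and "0 \<le> h" and eq: "\<And>t. \<tau> - h \<le> t \<Longrightarrow> u t = v t"
  shows "is_solution a b h f \<tau> \<phi> v"
  unfolding is_solution_def
proof (intro conjI ballI allI impI)
  have "continuous_on {\<tau> - h..} u" using u by (simp add: is_solution_def)
  then show "continuous_on {\<tau> - h..} v" by (rule continuous_on_eq) (simp add: eq)
  show "v (\<tau> + s) = \<phi> s" if "s \<in> {-h..0}" for s
    using u eq [of "\<tau> + s"] that by (simp add: is_solution_def)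
  fix t assume t: "\<tau> \<le> t"
  have "(u has_real_derivative (a * u t + b * (SUP s\<in>{t - h..t}. u s) + f t)) (at t within {\<tau>..})"
    using u t by (simp add: is_solution_def)
  moreover have "(SUP s\<in>{t - h..t}. u s) = (SUP s\<in>{t - h..t}. v s)"
    by (rule SUP_cong) (use eq t in auto)
  moreover have "u t = v t" using eq [of t] t \<open>0 \<le> h\<close> by simp
  ultimately have "(u has_real_derivative (a * v t + b * (SUP s\<in>{t - h..t}. v s) + f t)) (at t within {\<tau>..})"
    by simp
  then show "(v has_real_derivative (a * v t + b * (SUP s\<in>{t - h..t}. v s) + f t)) (at t within {\<tau>..})"
    by (rule has_field_derivative_transform_within [OF _ zero_less_one])
       (use eq t \<open>0 \<le> h\<close> in auto)
qed

lemma is_solution_restart: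
  assumes u: "is_solution a b h f \<tau> \<phi> u" and "0 \<le> \<mu>"
  shows "is_solution a b h f (\<tau> + \<mu>) (history_segment h u (\<tau> + \<mu>)) u"
  unfolding is_solution_def
proof (intro conjI ballI allI impI)
  have "continuous_on {\<tau> - h..} u" using u by (simp add: is_solution_def)
  then show "continuous_on {\<tau> + \<mu> - h..} u" by (rule continuous_on_subset) (use \<open>0 \<le> \<mu>\<close> in auto)
  show "u (\<tau> + \<mu> + s) = history_segment h u (\<tau> + \<mu>) s" if "s \<in> {-h..0}" for s
    using that by (simp add: history_segment_def)
  fix t assume "\<tau> + \<mu> \<le> t"
  then have "(u has_real_derivative (a * u t + b * (SUP s\<in>{t - h..t}. u s) + f t)) (at t within {\<tau>..})"
    using u \<open>0 \<le> \<mu>\<close> by (simp add: is_solution_def)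
  then show "(u has_real_derivative (a * u t + b * (SUP s\<in>{t - h..t}. u s) + f t)) (at t within {\<tau> + \<mu>..})"
    by (rule has_field_derivative_subset) (use \<open>0 \<le> \<mu>\<close> in auto)
qed

lemma solution_eq:
  assumes u: "is_solution a b h f \<tau> \<phi> u" and "0 \<le> h" "\<tau> - h \<le> t"
  shows "solution a b h f \<tau> \<phi> t = u t"
proof -
  let ?v = "restrict u {\<tau> - h..}"
  have v: "is_solution a b h f \<tau> \<phi> ?v"
    by (rule is_solution_cong [OF u \<open>0 \<le> h\<close>]) simp
  have "solution a b h f \<tau> \<phi> = ?v"
    unfolding solution_def
  proof (rule the_equality)
    show "w = ?v" if "w \<in> extensional {\<tau> - h..} \<and> is_solution a b h f \<tau> \<phi> w" for w
    proof (rule extensionalityI [where A = "{\<tau> - h..}"])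
      show "w x = ?v x" if "x \<in> {\<tau> - h..}" for x
        using is_solution_unique [OF conjunct2 [OF \<open>w \<in> _ \<and> _\<close>] v \<open>0 \<le> h\<close>] that by simp
    qed (use that in auto)
  qed (use v in auto)
  then show ?thesis using assms by simp
qed

locale periodic_maxima_equation =
  fixes a b h T :: real and f :: "real \<Rightarrow> real"
  assumes h_pos: "0 < h" and T_pos: "0 < T"
    and cont_f: "continuous_on UNIV f" and periodic_f: "\<And>t. f (t + T) = f t"
begin

lemma periodic_int: "f (t + of_int k * T) = f t"
proof -
  interpret periodic_fun_simple f T by standard (rule periodic_f)
  show ?thesis by (rule plus_of_int)
qed

lemma f_bounded: obtains K where "0 \<le> K" "\<And>t. \<bar>f t\<bar> \<le> K"
proof -
  have "bounded (f ` {0..T})"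
    by (intro compact_imp_bounded compact_continuous_image continuous_on_subset [OF cont_f]) auto
  then obtain K where K: "\<forall>t\<in>{0..T}. \<bar>f t\<bar> \<le> K" by (auto simp: bounded_iff)
  have "\<bar>f t\<bar> \<le> K" for t
  proof -
    obtain k :: int where "t = t rmod T + of_int k * T" using rmod_eq_add_period by blast
    then have "f t = f (t rmod T)" using periodic_int by metis
    moreover have "t rmod T \<in> {0..T}" using T_pos by (simp add: rmod_nonneg rmod_le)
    ultimately show ?thesis using K by simp
  qed
  moreover from this [of 0] have "0 \<le> K" by simp
  ultimately show thesis by (rule that [rotated])
qed

lemma is_solution_solution:
  assumes "\<phi> \<in> mspace (history_space h)"
  shows "is_solution a b h f \<tau> \<phi> (solution a b h f \<tau> \<phi>)"
proof -
  obtain K where K: "0 \<le> K" "\<And>t. \<bar>f t\<bar> \<le> K" using f_bounded by metis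
  have "\<exists>u. is_solution a b h (\<lambda>t. f (t + \<tau>)) 0 \<phi> u"
  proof (rule solution_0_exists [where K = K])
    show "continuous_on UNIV (\<lambda>t. f (t + \<tau>))"
      by (rule continuous_on_compose2 [OF cont_f]) (auto intro!: continuous_intros)
  qed (use K assms h_pos in \<open>auto simp: mspace_history_space\<close>)
  then obtain u where "is_solution a b h (\<lambda>t. f (t + \<tau>)) 0 \<phi> u" ..
  from is_solution_shift [OF this, of "- \<tau>"]
  have u: "is_solution a b h f \<tau> \<phi> (\<lambda>t. u (t - \<tau>))" by simp
  show ?thesis
    by (rule is_solution_cong [OF u]) (use solution_eq [OF u] h_pos in auto)
qed

abbreviation "F \<equiv> semiflow_map a b h T f"

lemma F_eq: "F \<mu> (\<tau>, \<phi>) = ((\<tau> + \<mu>) rmod T, history_segment h (solution a b h f \<tau> \<phi>) (\<tau> + \<mu>))"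
  by (simp add: semiflow_map_def history_segment_def)

lemma F_segment_in_mspace:
  assumes "\<phi> \<in> mspace (history_space h)" "0 \<le> \<mu>"
  shows "snd (F \<mu> (\<tau>, \<phi>)) \<in> mspace (history_space h)"
proof -
  have "continuous_on {\<tau> - h..} (solution a b h f \<tau> \<phi>)"
    using is_solution_solution [OF assms(1)] by (simp add: is_solution_def)
  then have "continuous_on {\<tau> + \<mu> - h..\<tau> + \<mu>} (solution a b h f \<tau> \<phi>)"
    by (rule continuous_on_subset) (use assms(2) in auto)
  then show ?thesis unfolding F_eq snd_conv by (rule history_segment_in_mspace)
qed

text \<open>
  By periodicity of \<open>f\<close> the initial time matters only modulo \<open>T\<close>. In particular \<open>F \<mu>\<close> makes sense for
  initial times outside \<open>{0..<T}\<close>.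
\<close>

lemma F_add_period:
  assumes "\<phi> \<in> mspace (history_space h)" "0 \<le> \<mu>"
  shows "F \<mu> (\<tau> + of_int k * T, \<phi>) = F \<mu> (\<tau>, \<phi>)"
proof -
  let ?c = "of_int k * T"
  have "is_solution a b h (\<lambda>t. f (t - ?c)) (\<tau> + ?c) \<phi> (\<lambda>t. solution a b h f \<tau> \<phi> (t - ?c))"
    using is_solution_shift [OF is_solution_solution [OF assms(1)], where \<tau> = \<tau> and c = "- ?c"] by simp
  moreover have "f (t - ?c) = f t" for t using periodic_int [of "t - ?c" k] by simp
  ultimately have "is_solution a b h f (\<tau> + ?c) \<phi> (\<lambda>t. solution a b h f \<tau> \<phi> (t - ?c))" by simp
  from solution_eq [OF this]
  have "solution a b h f (\<tau> + ?c) \<phi> (\<tau> + ?c + \<mu> + s) = solution a b h f \<tau> \<phi> (\<tau> + \<mu> + s)"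
    if "s \<in> {-h..0}" for s
    using that h_pos \<open>0 \<le> \<mu>\<close> by (auto simp: algebra_simps)
  then have "history_segment h (solution a b h f (\<tau> + ?c) \<phi>) (\<tau> + ?c + \<mu>)
      = history_segment h (solution a b h f \<tau> \<phi>) (\<tau> + \<mu>)"
    unfolding history_segment_def by (intro restrict_ext)
  moreover have "(\<tau> + ?c + \<mu>) rmod T = (\<tau> + \<mu>) rmod T"
  proof -
    obtain m :: int where m: "\<tau> + \<mu> = (\<tau> + \<mu>) rmod T + of_int m * T" using rmod_eq_add_period by blast
    show ?thesis
    proof (rule rmod_unique)
      show "(\<tau> + \<mu>) rmod T \<in> {0..<\<bar>T\<bar>}" using T_pos by (simp add: rmod_nonneg rmod_less)
      show "\<tau> + ?c + \<mu> = (\<tau> + \<mu>) rmod T + of_int (m + k) * T"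
        using m by (simp add: algebra_simps)
    qed
  qed
  ultimately show ?thesis unfolding F_eq by simp
qed

lemma F_semigroup:
  assumes "\<phi> \<in> mspace (history_space h)" "0 \<le> s" "0 \<le> t"
  shows "F (s + t) (\<tau>, \<phi>) = F s (F t (\<tau>, \<phi>))"
proof -
  let ?u = "solution a b h f \<tau> \<phi>"
  let ?\<psi> = "history_segment h ?u (\<tau> + t)"
  have \<psi>: "?\<psi> \<in> mspace (history_space h)"
    using F_segment_in_mspace [OF assms(1,3)] by (simp add: F_eq)
  obtain k :: int where k: "\<tau> + t = (\<tau> + t) rmod T + of_int k * T" using rmod_eq_add_period by blast
  have "F s (F t (\<tau>, \<phi>)) = F s ((\<tau> + t) rmod T + of_int k * T, ?\<psi>)"
    unfolding F_add_period [OF \<psi> \<open>0 \<le> s\<close>] by (simp add: F_eq)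
  also have "\<dots> = F s (\<tau> + t, ?\<psi>)" using k by simp
  also have "\<dots> = F (s + t) (\<tau>, \<phi>)"
  proof -
    have "solution a b h f (\<tau> + t) ?\<psi> (\<tau> + t + s + r) = ?u (\<tau> + t + s + r)" if "r \<in> {-h..0}" for r
      by (rule solution_eq [OF is_solution_restart [OF is_solution_solution [OF assms(1)] \<open>0 \<le> t\<close>]])
         (use that h_pos \<open>0 \<le> s\<close> in auto)
    then have "history_segment h (solution a b h f (\<tau> + t) ?\<psi>) (\<tau> + t + s)
        = history_segment h ?u (\<tau> + t + s)"
      unfolding history_segment_def by (intro restrict_ext)
    then show ?thesis unfolding F_eq by (simp add: algebra_simps)
  qed
  finally show ?thesis ..
qed

text \<open>
  Continuous dependence on the history and the initial time at once. The two cases of the proof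
  are the parts of the segment after and before the initial time.
\<close>

lemma history_segment_difference:
  assumes "\<phi> \<in> mspace (history_space h)" "\<psi> \<in> mspace (history_space h)" "0 < D"
    and init: "\<And>s. s \<in> {-h..0} \<Longrightarrow> \<bar>\<phi> s - \<psi> s\<bar> < D"
    and forcing: "\<And>s. s \<in> {0..\<mu>} \<Longrightarrow> \<bar>f (s + \<tau>) - f (s + \<sigma>)\<bar> \<le> D" and "0 \<le> \<mu>"
  shows "mdist (history_space h) (snd (F \<mu> (\<tau>, \<phi>))) (snd (F \<mu> (\<sigma>, \<psi>))) \<le> D * exp ((\<bar>a\<bar> + \<bar>b\<bar> + 1) * \<mu>)"
proof -
  let ?L = "\<bar>a\<bar> + \<bar>b\<bar> + 1"
  let ?u = "\<lambda>t. solution a b h f \<tau> \<phi> (t + \<tau>)" and ?v = "\<lambda>t. solution a b h f \<sigma> \<psi> (t + \<sigma>)"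
  note u = is_solution_shift_to_0 [OF is_solution_solution [OF assms(1)], of \<tau>]
  note v = is_solution_shift_to_0 [OF is_solution_solution [OF assms(2)], of \<sigma>]
  have "\<bar>?u (\<mu> + s) - ?v (\<mu> + s)\<bar> \<le> D * exp (?L * \<mu>)" if s: "s \<in> {-h..0}" for s
  proof (cases "0 \<le> \<mu> + s")
    case True
    have "\<bar>?u (\<mu> + s) - ?v (\<mu> + s)\<bar> \<le> D * exp (?L * (\<mu> + s))"
      by (rule solution_difference_bound [OF u v, where T = \<mu>])
         (use h_pos \<open>0 < D\<close> init forcing True s in auto)
    also have "\<dots> \<le> D * exp (?L * \<mu>)"
    proof -
      have "?L * (\<mu> + s) \<le> ?L * \<mu>" using s by (intro mult_left_mono) auto
      then show ?thesis using \<open>0 < D\<close> by simp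
    qed
    finally show ?thesis .
  next
    case False
    then have "\<mu> + s \<in> {-h..0}" using s \<open>0 \<le> \<mu>\<close> by auto
    then have "\<bar>?u (\<mu> + s) - ?v (\<mu> + s)\<bar> < D"
      using is_solution_0D(2) [OF u] is_solution_0D(2) [OF v] init by simp
    also have "D * 1 \<le> D * exp (?L * \<mu>)" using \<open>0 < D\<close> \<open>0 \<le> \<mu>\<close> by (intro mult_left_mono) auto
    finally show ?thesis by simp
  qed
  then have "\<bar>snd (F \<mu> (\<tau>, \<phi>)) s - snd (F \<mu> (\<sigma>, \<psi>)) s\<bar> \<le> D * exp (?L * \<mu>)" if "s \<in> {-h..0}" for s
  proof -
    have "\<tau> + \<mu> + s = \<mu> + s + \<tau>" "\<sigma> + \<mu> + s = \<mu> + s + \<sigma>" by simp_all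
    then show ?thesis
      using that \<open>\<And>s. s \<in> {-h..0} \<Longrightarrow> \<bar>?u (\<mu> + s) - ?v (\<mu> + s)\<bar> \<le> D * exp (?L * \<mu>)\<close> [OF that]
      by (simp only: F_eq history_segment_def snd_conv restrict_apply if_True)
  qed
  then show ?thesis
    using mdist_history_space_le F_segment_in_mspace assms h_pos by (metis less_imp_le)
qed

text \<open>
  The initial time enters only as a shift of the uniformly continuous \<open>f\<close>.
\<close>

lemma continuous_map_F_lift:
  assumes "0 \<le> \<mu>"
  shows "continuous_map (prod_topology (top_of_set {0..T}) (mtopology_of (history_space h)))
    (mtopology_of (history_space h)) (\<lambda>x. snd (F \<mu> x))"
proof -
  let ?M = "mspace (history_space h)" and ?d = "mdist (history_space h)"
  let ?X = "prod_topology (top_of_set {0..T}) (mtopology_of (history_space h))"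
  have "\<exists>U. openin ?X U \<and> x \<in> U \<and> (\<forall>y\<in>U. snd (F \<mu> y) \<in> Metric_space.mball ?M ?d (snd (F \<mu> x)) e)"
    if x: "x \<in> topspace ?X" and e: "0 < e" for x e
  proof -
    obtain \<tau> \<phi> where x_eq: "x = (\<tau>, \<phi>)" by fastforce
    then have \<tau>: "\<tau> \<in> {0..T}" and \<phi>: "\<phi> \<in> ?M" using x by auto
    define m where "m = exp ((\<bar>a\<bar> + \<bar>b\<bar> + 1) * \<mu>)"
    define D where "D = e / (2 * m)"
    have D: "0 < D" "D * m < e" using e by (auto simp: D_def m_def)
    have "uniformly_continuous_on {0..T + \<mu>} f"
      by (intro compact_uniformly_continuous continuous_on_subset [OF cont_f]) auto
    then obtain d where d: "0 < d"
      "\<And>s t. \<lbrakk>s \<in> {0..T + \<mu>}; t \<in> {0..T + \<mu>}; dist t s < d\<rbrakk> \<Longrightarrow> dist (f t) (f s) < D"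
      unfolding uniformly_continuous_on_def using D(1) by metis
    define U where "U = ({0..T} \<inter> ball \<tau> d) \<times> Metric_space.mball ?M ?d \<phi> D"
    have "openin ?X U"
      unfolding U_def openin_prod_Times_iff mtopology_of_def
      by (simp add: openin_open_Int Metric_space.openin_mball [OF Metric_space_history])
    moreover have "x \<in> U"
      using x_eq \<tau> \<phi> d(1) D(1) by (simp add: U_def Metric_space.centre_in_mball_iff [OF Metric_space_history])
    moreover have "snd (F \<mu> y) \<in> Metric_space.mball ?M ?d (snd (F \<mu> x)) e" if "y \<in> U" for y
    proof -
      obtain \<sigma> \<psi> where y_eq: "y = (\<sigma>, \<psi>)" by fastforce
      then have \<sigma>: "\<sigma> \<in> {0..T}" "dist \<tau> \<sigma> < d" and \<psi>: "\<psi> \<in> ?M" "?d \<phi> \<psi> < D"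
        using that by (auto simp: U_def Metric_space.in_mball [OF Metric_space_history])
      have "?d (snd (F \<mu> (\<tau>, \<phi>))) (snd (F \<mu> (\<sigma>, \<psi>))) \<le> D * m"
        unfolding m_def
      proof (rule history_segment_difference [OF \<phi> \<psi>(1) D(1) _ _ assms])
        show "\<bar>\<phi> s - \<psi> s\<bar> < D" if "s \<in> {-h..0}" for s
          using mdist_history_space_le [of h \<phi> \<psi> "?d \<phi> \<psi>"] \<phi> \<psi> h_pos that by force
        show "\<bar>f (s + \<tau>) - f (s + \<sigma>)\<bar> \<le> D" if "s \<in> {0..\<mu>}" for s
        proof -
          have "dist (f (s + \<tau>)) (f (s + \<sigma>)) < D"
            by (rule d(2)) (use that \<tau> \<sigma> in \<open>auto simp: dist_real_def\<close>)
          then show ?thesis by (simp add: dist_real_def)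
        qed
      qed
      then show ?thesis
        using F_segment_in_mspace [OF \<phi> assms] F_segment_in_mspace [OF \<psi>(1) assms] D(2)
        by (simp add: Metric_space.in_mball [OF Metric_space_history] x_eq y_eq)
    qed
    ultimately show ?thesis by blast
  qed
  then show ?thesis
    by (subst (2) mtopology_of_def)
       (simp add: Metric_space.continuous_map_to_metric [OF Metric_space_history])
qed

lemma continuous_map_F:
  assumes "0 \<le> \<mu>"
  shows "continuous_map (phase_space T h) (phase_space T h) (F \<mu>)"
proof (rule continuous_compose_quotient_map [OF quotient_map_phase_space [OF T_pos]])
  let ?X = "prod_topology (top_of_set {0..T}) (mtopology_of (history_space h))"
  let ?q = "\<lambda>(t, \<phi>). (circle_proj T t, \<phi>)"
  have cF: "continuous_map ?X (phase_space T h) (F \<mu>)"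
    unfolding phase_space_def continuous_map_pairwise
  proof
    have "continuous_map ?X euclidean (\<lambda>x. fst x + \<mu>)"
    proof (rule continuous_map_add)
      have "continuous_map ?X (top_of_set {0..T}) fst" by (rule continuous_map_fst)
      then show "continuous_map ?X euclidean fst" by (simp add: continuous_map_in_subtopology)
    qed simp
    then have "continuous_map ?X (circle_topology T) ((\<lambda>t. t rmod T) \<circ> (\<lambda>x. fst x + \<mu>))"
      by (rule continuous_map_compose [OF _ continuous_map_rmod [OF T_pos]])
    moreover have "fst \<circ> F \<mu> = (\<lambda>t. t rmod T) \<circ> (\<lambda>x. fst x + \<mu>)" by (auto simp: F_eq)
    ultimately show "continuous_map ?X (circle_topology T) (fst \<circ> F \<mu>)" by simp
    show "continuous_map ?X (mtopology_of (history_space h)) (snd \<circ> F \<mu>)"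
      using continuous_map_F_lift [OF assms] by (simp add: o_def)
  qed
  have eq: "F \<mu> x = (F \<mu> \<circ> ?q) x" if "x \<in> topspace ?X" for x
  proof -
    obtain t \<phi> where x: "x = (t, \<phi>)" by fastforce
    then show ?thesis
      using F_add_period [OF _ assms, of \<phi> 0 1] that by (auto simp: circle_proj_def)
  qed
  show "continuous_map ?X (phase_space T h) (F \<mu> \<circ> ?q)"
    by (rule continuous_map_eq [OF cF eq])
qed

text \<open>
  From dissipativity to compactness: \<open>\<bar>u\<bar> \<le> R0\<close> holds from time \<open>t0\<close> on, the equation then bounds the
  slope one delay later, when the whole window is controlled, and the whole history is Lipschitz
  after a second delay.
\<close>

lemma eventually_in_lipschitz_ball:
  assumes cond: "(a + b < 0 \<and> a * h \<le> 1) \<or> (b * h < - exp (a * h - 1) \<and> a * h \<ge> 1)"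
  obtains R0 L where "0 \<le> R0" "0 \<le> L"
    "\<And>R. 0 \<le> R \<Longrightarrow> \<exists>p>0. \<forall>\<mu>\<ge>p. \<forall>\<tau>. \<forall>\<phi>\<in>mspace (history_space h).
      (\<forall>s\<in>{-h..0}. \<bar>\<phi> s\<bar> \<le> R) \<longrightarrow> snd (F \<mu> (\<tau>, \<phi>)) \<in> lipschitz_ball h R0 L"
proof -
  obtain K where K: "0 \<le> K" "\<And>t. \<bar>f t\<bar> \<le> K" using f_bounded by metis
  obtain R0 where R0: "0 \<le> R0"
    and diss: "\<And>R. 0 \<le> R \<Longrightarrow> \<exists>t0\<ge>0. \<forall>f \<phi> u t. is_solution a b h f 0 \<phi> u \<longrightarrow>
      (\<forall>s. \<bar>f s\<bar> \<le> K) \<longrightarrow> (\<forall>s\<in>{-h..0}. \<bar>\<phi> s\<bar> \<le> R) \<longrightarrow> t0 \<le> t \<longrightarrow> \<bar>u t\<bar> \<le> R0"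
    using uniformly_dissipative [OF h_pos cond K(1)] by blast
  define L where "L = (\<bar>a\<bar> + \<bar>b\<bar>) * R0 + K"
  have L: "0 \<le> L" using K(1) R0 by (simp add: L_def)
  show thesis
  proof (rule that [OF R0 L])
    fix R :: real assume "0 \<le> R"
    then obtain t0 where "0 \<le> t0" and t0: "\<And>f \<phi> u t. \<lbrakk>is_solution a b h f 0 \<phi> u; \<forall>s. \<bar>f s\<bar> \<le> K;
        \<forall>s\<in>{-h..0}. \<bar>\<phi> s\<bar> \<le> R; t0 \<le> t\<rbrakk> \<Longrightarrow> \<bar>u t\<bar> \<le> R0"
      using diss by blast
    have "snd (F \<mu> (\<tau>, \<phi>)) \<in> lipschitz_ball h R0 L"
      if \<mu>: "t0 + 2 * h \<le> \<mu>" and \<phi>: "\<phi> \<in> mspace (history_space h)" "\<forall>s\<in>{-h..0}. \<bar>\<phi> s\<bar> \<le> R" for \<mu> \<tau> \<phi>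
    proof -
      let ?u = "\<lambda>t. solution a b h f \<tau> \<phi> (t + \<tau>)" and ?g = "\<lambda>t. f (t + \<tau>)"
      note u = is_solution_shift_to_0 [OF is_solution_solution [OF \<phi>(1)], of \<tau>]
      note U = is_solution_0D [OF u]
      have bd: "\<bar>?u t\<bar> \<le> R0" if "t0 \<le> t" for t
        by (rule t0 [OF u]) (use K(2) \<phi>(2) that in auto)
      have slope: "\<bar>max_rhs a b h ?g ?u t\<bar> \<le> L" if t: "t0 + h \<le> t" for t
      proof -
        obtain s where s: "s \<in> {t - h..t}" "(SUP s\<in>{t - h..t}. ?u s) = ?u s"
          by (rule window_sup_attained [OF U(4) [of t]]) (use t \<open>0 \<le> t0\<close> h_pos in auto)
        then have "\<bar>SUP s\<in>{t - h..t}. ?u s\<bar> \<le> R0" using bd [of s] t by simp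
        then have "\<bar>b * (SUP s\<in>{t - h..t}. ?u s)\<bar> \<le> \<bar>b\<bar> * R0" by (simp add: abs_mult mult_left_mono)
        moreover have "\<bar>a * ?u t\<bar> \<le> \<bar>a\<bar> * R0" using bd [of t] t h_pos by (simp add: abs_mult mult_left_mono)
        ultimately show ?thesis using K(2) [of "t + \<tau>"] by (simp add: max_rhs_def L_def algebra_simps)
      qed
      have lip: "\<bar>?u x - ?u y\<bar> \<le> L * \<bar>x - y\<bar>" if "t0 + h \<le> x" "t0 + h \<le> y" for x y
      proof -
        have "norm (?u x - ?u y) \<le> L * norm (x - y)"
        proof (rule field_differentiable_bound [of "{t0 + h..}" ?u "max_rhs a b h ?g ?u"])
          show "(?u has_real_derivative max_rhs a b h ?g ?u z) (at z within {t0 + h..})" if "z \<in> {t0 + h..}" for z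
            by (rule has_field_derivative_subset [OF U(3)]) (use that \<open>0 \<le> t0\<close> h_pos in auto)
        qed (use slope that in auto)
        then show ?thesis by simp
      qed
      show ?thesis unfolding F_eq snd_conv
      proof (rule lipschitz_ballI [OF L])
        show "\<bar>history_segment h (solution a b h f \<tau> \<phi>) (\<tau> + \<mu>) s\<bar> \<le> R0" if "s \<in> {-h..0}" for s
          using bd [of "\<mu> + s"] that \<mu> h_pos by (auto simp: history_segment_def algebra_simps)
        show "\<bar>history_segment h (solution a b h f \<tau> \<phi>) (\<tau> + \<mu>) s
            - history_segment h (solution a b h f \<tau> \<phi>) (\<tau> + \<mu>) t\<bar> \<le> L * \<bar>s - t\<bar>"
          if "s \<in> {-h..0}" "t \<in> {-h..0}" for s t
          using lip [of "\<mu> + s" "\<mu> + t"] that \<mu> h_pos by (auto simp: history_segment_def algebra_simps)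
      qed (simp add: history_segment_def)
    qed
    then show "\<exists>p>0. \<forall>\<mu>\<ge>p. \<forall>\<tau>. \<forall>\<phi>\<in>mspace (history_space h).
      (\<forall>s\<in>{-h..0}. \<bar>\<phi> s\<bar> \<le> R) \<longrightarrow> snd (F \<mu> (\<tau>, \<phi>)) \<in> lipschitz_ball h R0 L"
      using \<open>0 \<le> t0\<close> h_pos by (intro exI [of _ "t0 + 2 * h"]) auto
  qed
qed

theorem compact_global_attractor_exists:
  assumes cond: "(a + b < 0 \<and> a * h \<le> 1) \<or> (b * h < - exp (a * h - 1) \<and> a * h \<ge> 1)"
  shows "\<exists>A. compact_global_attractor (phase_space T h) F A"
proof -
  obtain R0 L where R0: "0 \<le> R0" and L: "0 \<le> L"
    and ev: "\<And>R. 0 \<le> R \<Longrightarrow> \<exists>p>0. \<forall>\<mu>\<ge>p. \<forall>\<tau>. \<forall>\<phi>\<in>mspace (history_space h).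
      (\<forall>s\<in>{-h..0}. \<bar>\<phi> s\<bar> \<le> R) \<longrightarrow> snd (F \<mu> (\<tau>, \<phi>)) \<in> lipschitz_ball h R0 L"
    using eventually_in_lipschitz_ball [OF cond] by metis
  define B where "B = lipschitz_ball h R0 L"
  obtain p where "0 < p" and p: "\<And>\<mu> \<tau> \<phi>. \<lbrakk>p \<le> \<mu>; \<phi> \<in> B\<rbrakk> \<Longrightarrow> snd (F \<mu> (\<tau>, \<phi>)) \<in> B"
  proof -
    obtain p where "0 < p" and p: "\<forall>\<mu>\<ge>p. \<forall>\<tau>. \<forall>\<phi>\<in>mspace (history_space h).
        (\<forall>s\<in>{-h..0}. \<bar>\<phi> s\<bar> \<le> R0) \<longrightarrow> snd (F \<mu> (\<tau>, \<phi>)) \<in> B"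
      using ev [OF R0] unfolding B_def by (elim exE conjE)
    have "snd (F \<mu> (\<tau>, \<phi>)) \<in> B" if "p \<le> \<mu>" "\<phi> \<in> B" for \<mu> \<tau> \<phi>
      using p that unfolding B_def lipschitz_ball_def by simp
    then show thesis using that [OF \<open>0 < p\<close>] by simp
  qed
  have fst: "fst (F \<mu> (\<tau>, \<phi>)) \<in> {0..<T}" for \<mu> \<tau> \<phi>
    using T_pos by (simp add: F_eq rmod_nonneg rmod_less)
  note top = topspace_phase_space [OF T_pos, of h]
  show ?thesis
  proof (rule attractor_from_absorbing_set)
    show "Hausdorff_space (phase_space T h)" by (rule Hausdorff_space_phase_space [OF T_pos])
    show "continuous_map (phase_space T h) (phase_space T h) (F t)" if "0 \<le> t" for t
      by (rule continuous_map_F [OF that])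
    show "F (s + t) x = F s (F t x)" if "0 \<le> s" "0 \<le> t" "x \<in> topspace (phase_space T h)" for s t x
      using that F_semigroup by (auto simp: top)
    have "compactin (circle_topology T) {0..<T}"
      using compact_space_circle_topology [OF T_pos] by (simp add: compact_space_def topspace_circle_topology T_pos)
    then show "compactin (phase_space T h) ({0..<T} \<times> B)"
      unfolding phase_space_def compactin_Times B_def using compactin_lipschitz_ball h_pos L by simp
    show "connectedin (phase_space T h) ({0..<T} \<times> B)"
      unfolding phase_space_def connectedin_Times B_def
      using connectedin_lipschitz_ball connectedin_circle_topology h_pos L R0 T_pos by simp
    show "{0..<T} \<times> B \<noteq> {}" using zero_in_lipschitz_ball [OF R0 L] T_pos unfolding B_def by auto
    show "F t ` ({0..<T} \<times> B) \<subseteq> {0..<T} \<times> B" if "p \<le> t" for t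
    proof
      fix y assume "y \<in> F t ` ({0..<T} \<times> B)"
      then obtain \<tau> \<phi> where "\<phi> \<in> B" and y: "y = F t (\<tau>, \<phi>)" by auto
      then show "y \<in> {0..<T} \<times> B" unfolding y mem_Times_iff using p [OF that] fst by blast
    qed
    show "\<exists>t\<ge>0. F t x \<in> {0..<T} \<times> B" if "x \<in> topspace (phase_space T h)" for x
    proof -
      obtain \<tau> \<phi> where x: "x = (\<tau>, \<phi>)" "\<phi> \<in> mspace (history_space h)" using \<open>x \<in> _\<close> by (auto simp: top)
      have "bounded (\<phi> ` {-h..0})"
        using x(2) compact_continuous_image compact_imp_bounded by (auto simp: mspace_history_space)
      then obtain R where R: "\<forall>s\<in>{-h..0}. \<bar>\<phi> s\<bar> \<le> R" by (auto simp: bounded_iff)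
      then have "\<bar>\<phi> 0\<bar> \<le> R" using h_pos by simp
      then have "0 \<le> R" by simp
      then obtain q where "0 < q" "snd (F q (\<tau>, \<phi>)) \<in> B"
        using ev [of R] R x(2) unfolding B_def by blast
      then show ?thesis using fst [of q \<tau> \<phi>] x(1) unfolding mem_Times_iff by (intro exI [of _ q]) simp
    qed
  qed (fact \<open>0 < p\<close>)
qed

end

theorem theorem9:
  fixes a b h T :: real and f :: "real \<Rightarrow> real"
  assumes "0 < h" and "h < T"
    and "(a + b < 0 \<and> a * h \<le> 1) \<or> (b * h < - exp (a * h - 1) \<and> a * h \<ge> 1)"
    and "continuous_on UNIV f"
    and "\<forall>t. f (t + T) = f t"
    and "sine_like_shape T f"
  shows "\<exists>A. compact_global_attractor (phase_space T h) (semiflow_map a b h T f) A"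
proof -
  interpret periodic_maxima_equation a b h T f
    by standard (use assms in auto)
  show ?thesis by (rule compact_global_attractor_exists) fact
qed

end
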